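(* Let $T>0$, $I=[0,T]$, $q\in(0,1]$, let $\mathcal{H}_1,\mathcal{H}_2$ be real Hilbert spaces, let $\Omega\subset\mathcal{H}_2$ be nonempty, closed and convex, let $K:\Omega\to 2^{\Omega}$ be a set-valued mapping with nonempty closed convex values, let $f:I\times\mathcal{H}_1\to\mathcal{H}_1$, $g:I\times\mathcal{H}_1\times\mathcal{H}_2\to\mathcal{H}_1$, $G:I\times\mathcal{H}_1\times\Omega\to\mathcal{H}_2$, $\psi:C(I,\mathcal{H}_1)\to\mathcal{H}_1$, and $x_0\in\mathcal{H}_1$. Assume: (1) there are constants $l_G,\eta_G>0$ such that $\|G(s_2,x_2,u_2)-G(s_1,x_1,u_1)\|\le l_G(|s_2-s_1|+\|x_2-x_1\|+\|u_2-u_1\|)$ for all $s_1,s_2\in I$, $x_1,x_2\in\mathcal{H}_1$, $u_1,u_2\in\Omega$, and, for all $s\in I$, $x\in\mathcal{H}_1$, $u\in\Omega$ and $u_1,u_2\in K(u)$, $\langle G(s,x,u_2),u_1-u_2\rangle\ge 0$ implies $\langle G(s,x,u_1),u_1-u_2\rangle\ge\eta_G\|u_1-u_2\|^2$; (2) there is $l_K\ge 0$ such that $\|P_{K(u_2)}[\varpi]-P_{K(u_1)}[\varpi]\|\le l_K\|u_2-u_1\|$ for all $u_1,u_2\in\Omega$, $\varpi\in\mathcal{H}_2$; (3) $g$ is continuous and there is $l_g>0$ with $\|g(s,x_2,u_2)-g(s,x_1,u_1)\|\le l_g(\|x_2-x_1\|+\|u_2-u_1\|)$ for all $s\in I$,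 $x_1,x_2\in\mathcal{H}_1$, $u_1,u_2\in\mathcal{H}_2$; (4) $f$ is continuous and there is $l_f>0$ with $\|f(s,x_2)-f(s,x_1)\|\le l_f\|x_2-x_1\|$ for all $s\in I$, $x_1,x_2\in\mathcal{H}_1$; (5) $\psi$ is continuous and there is $0<l_\psi<1$ with $\|\psi(y_2)-\psi(y_1)\|\le l_\psi\|y_2-y_1\|_{\mathcal{B}}$ for all $y_1,y_2\in C(I,\mathcal{H}_1)$; (6) $2\dfrac{l_K^2}{\eta_G^2}\left(l_G\sqrt{4l_G^2+2\eta_G^2}+2l_G^2+\eta_G^2\right)<1$. Then the nonlocal fractional differential quasi-variational inequality $$\begin{cases}{}^{C}_{0}\mathrm{D}_s^{q}x(s)=f(s,x(s))+g(s,x(s),u(s)), & s\in I,\\ u(s)\in\mathrm{SOL}(K(\cdot),G(s,x(s),\cdot)), & s\in I,\\ x(0)=x_0+\psi(x)\end{cases}$$ has a unique solution $(x,u)\in C(I,\mathcal{H}_1)\times C(I,\Omega)$.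
   Context: $P_C$ is the metric projection onto a nonempty closed convex set $C$. $C(I,Y)$ is the space of continuous functions $I\to Y$; $C(I,\mathcal{H}_1)$ is equipped with the Bielecki norm $\|x\|_{\mathcal{B}}=\max_{s\in I}e^{-\gamma s}\|x(s)\|$, where $\gamma>0$ is a given constant. ${}^{C}_{0}\mathrm{D}_s^{q}$ is the Caputo fractional derivative of order $q$: ${}^{C}_{0}\mathrm{D}_s^{q}x(s)={}_{0}\mathrm{D}_s^{q}(x(s)-x(0))$, where ${}_0\mathrm{D}_s^q x(s)=\frac{1}{\Gamma(1-q)}\frac{d}{ds}\int_0^s(s-\varsigma)^{-q}x(\varsigma)\,d\varsigma$ (and it is the classical derivative if $q=1$). $\mathrm{SOL}(K(\cdot),G(s,z,\cdot))$ is the set of all $w\in\Omega$ with $w\in K(w)$ and $\langle G(s,z,w),v-w\rangle\ge 0$ for all $v\in K(w)$. By definition, a pair $(x,u)\in C(I,\mathcal{H}_1)\times C(I,\Omega)$ is a solution of the problem if, for all $s\in I$, $$x(s)=x_0+\psi(x)+\frac{1}{\Gamma(q)}\int_0^s(s-\zeta)^{q-1}\left[f(\zeta,x(\zeta))+g(\zeta,x(\zeta),u(\zeta))\right]d\zeta$$ and $u(s)\in\mathrm{SOL}(K(\cdot),G(s,x(s),\cdot))$. Integrals are Bochner integrals.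
   Formalization: For an arbitrary given γ>0 the claim is false (uniqueness can fail), so γ in the Bielecki norm is taken sufficiently large: γ ≥ γ_0, where γ_0>0 depends only on q, l_G, η_G, l_K, l_g, l_f, l_ψ. *)

theory Defs
  imports "HOL-Analysis.Analysis"
begin

text \<open>
  The library's Bochner integral is restricted to second countable types, which would force the
  Hilbert spaces to be separable. The following three definitions repeat those of the library
  (approximation in mean by integrable simple functions) without that restriction.
\<close>

definition has_bochner_int ::
    "'s measure \<Rightarrow> ('s \<Rightarrow> 'a::real_normed_vector) \<Rightarrow> 'a \<Rightarrow> bool" where
  "has_bochner_int M h J \<longleftrightarrow>
     h \<in> borel_measurable M \<and>
     (\<exists>\<sigma>. (\<forall>i::nat. Bochner_Integration.simple_bochner_integrable M (\<sigma> i)) \<and>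
          (\<lambda>i. \<integral>\<^sup>+ z. ennreal (norm (h z - \<sigma> i z)) \<partial>M) \<longlonglongrightarrow> 0 \<and>
          (\<lambda>i. Bochner_Integration.simple_bochner_integral M (\<sigma> i)) \<longlonglongrightarrow> J)"

definition bochner_integrable :: "'s measure \<Rightarrow> ('s \<Rightarrow> 'a::real_normed_vector) \<Rightarrow> bool" where
  "bochner_integrable M h \<longleftrightarrow> (\<exists>J. has_bochner_int M h J)"

definition bochner_int :: "'s measure \<Rightarrow> ('s \<Rightarrow> 'a::real_normed_vector) \<Rightarrow> 'a" where
  "bochner_int M h = (THE J. has_bochner_int M h J)"

text \<open>
  Extensionality (the fixed value \<^term>\<open>undefined\<close> outside the interval) makes the elements of
  this set correspond bijectively to the continuous functions from \<open>[0,T]\<close> to \<open>Y\<close>, so that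
  uniqueness can be expressed by plain equality.
\<close>

definition cont_space :: "real \<Rightarrow> 'a::topological_space set \<Rightarrow> (real \<Rightarrow> 'a) set" where
  "cont_space T Y = {x \<in> {0..T} \<rightarrow>\<^sub>E Y. continuous_on {0..T} x}"

definition bielecki_norm :: "real \<Rightarrow> real \<Rightarrow> (real \<Rightarrow> 'a::real_normed_vector) \<Rightarrow> real" where
  "bielecki_norm \<gamma> T x = (SUP s\<in>{0..T}. exp (- (\<gamma> * s)) * norm (x s))"

definition bielecki_continuous ::
    "real \<Rightarrow> real \<Rightarrow> ((real \<Rightarrow> 'a::real_normed_vector) \<Rightarrow> 'a) \<Rightarrow> bool" where
  "bielecki_continuous \<gamma> T \<psi> \<longleftrightarrow>
     (\<forall>y\<in>cont_space T UNIV. \<forall>\<epsilon>>0. \<exists>\<delta>>0. \<forall>y'\<in>cont_space T UNIV.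
        bielecki_norm \<gamma> T (\<lambda>s. y' s - y s) < \<delta> \<longrightarrow> norm (\<psi> y' - \<psi> y) < \<epsilon>)"

text \<open>
  The library's \<^const>\<open>closest_point\<close> is only available for Heine-Borel (hence finite-dimensional)
  inner product spaces.
\<close>

definition metric_projection :: "'b::metric_space set \<Rightarrow> 'b \<Rightarrow> 'b" where
  "metric_projection C w = (THE p. p \<in> C \<and> (\<forall>v\<in>C. dist w p \<le> dist w v))"

definition SOL ::
    "'b::real_inner set \<Rightarrow> ('b \<Rightarrow> 'b set) \<Rightarrow> ('b \<Rightarrow> 'b) \<Rightarrow> 'b set" where
  "SOL \<Omega> K F = {w \<in> \<Omega>. w \<in> K w \<and> (\<forall>v\<in>K w. inner (F w) (v - w) \<ge> 0)}"

text \<open>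
  A solution of the nonlocal problem for the Caputo derivative of order \<open>q\<close> is by definition a
  solution of the integral equation below. The integrability clause records that the right-hand
  side is meaningful; at the single point \<open>\<zeta> = s\<close> the kernel has the irrelevant value
  \<open>0 powr (q - 1) = 0\<close>.
\<close>

definition is_solution ::
    "real \<Rightarrow> real \<Rightarrow> 'b::real_inner set \<Rightarrow> ('b \<Rightarrow> 'b set) \<Rightarrow>
     (real \<Rightarrow> 'a::real_normed_vector \<Rightarrow> 'a) \<Rightarrow> (real \<Rightarrow> 'a \<Rightarrow> 'b \<Rightarrow> 'a) \<Rightarrow>
     (real \<Rightarrow> 'a \<Rightarrow> 'b \<Rightarrow> 'b) \<Rightarrow> ((real \<Rightarrow> 'a) \<Rightarrow> 'a) \<Rightarrow> 'a \<Rightarrow>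
     (real \<Rightarrow> 'a) \<Rightarrow> (real \<Rightarrow> 'b) \<Rightarrow> bool" where
  "is_solution q T \<Omega> K f g G \<psi> x\<^sub>0 x u \<longleftrightarrow>
     x \<in> cont_space T UNIV \<and> u \<in> cont_space T \<Omega> \<and>
     (\<forall>s\<in>{0..T}.
        bochner_integrable (lebesgue_on {0..s})
          (\<lambda>\<zeta>. (s - \<zeta>) powr (q - 1) *\<^sub>R (f \<zeta> (x \<zeta>) + g \<zeta> (x \<zeta>) (u \<zeta>))) \<and>
        x s = x\<^sub>0 + \<psi> x + (1 / Gamma q) *\<^sub>R
          bochner_int (lebesgue_on {0..s})
            (\<lambda>\<zeta>. (s - \<zeta>) powr (q - 1) *\<^sub>R (f \<zeta> (x \<zeta>) + g \<zeta> (x \<zeta>) (u \<zeta>))) \<and>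
        u s \<in> SOL \<Omega> K (G s (x s)))"

text \<open>
  The weight \<open>\<gamma>\<close> of the Bielecki norm must be read as sufficiently large, as is usual for this
  norm, with a bound depending only on \<open>q\<close> and on the constants in the hypotheses. The claim fails
  for an arbitrary \<open>\<gamma> > 0\<close>: let \<open>0 < l < 1\<close>, \<open>q = 1\<close>, both Hilbert spaces and \<open>\<Omega>\<close> equal to the reals,
  \<open>K u = {0}\<close>, \<open>G s x u = u\<close>, \<open>g = 0\<close>, \<open>x\<^sub>0 = 0\<close>, \<open>f s x = \<lambda> x\<close> with \<open>\<lambda> = \<gamma> - ln l / T\<close>, and
  \<open>\<psi> y = l exp (- \<gamma> T) y(T)\<close>. All hypotheses hold, with Lipschitz constant \<open>l\<close> for \<open>\<psi>\<close>, but
  \<open>x s = c exp (\<lambda> s)\<close> and \<open>u = 0\<close> is a solution for every real \<open>c\<close>.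
\<close>

end

theory Submission
  imports Defs
begin

text \<open>
  The state equation and the quasi-variational inequality can be decoupled. For fixed \<open>s\<close> and \<open>x\<close> the
  inequality has exactly one solution \<open>U s x\<close>, and \<open>U\<close> is Lipschitz in \<open>(s, x)\<close>. Substituting it, the
  problem becomes one integral equation for \<open>x\<close> alone, with right-hand side
  \<open>h s x = f s x + g s x (U s x)\<close>, which is Lipschitz in \<open>x\<close> with a constant \<open>l\<close> built only from the
  constants in the hypotheses. Since
  \<open>\<integral>\<^bsub>0\<^esub>\<^bsup>s\<^esup> (s - \<zeta>)\<^bsup>q-1\<^esup> exp (\<gamma> \<zeta>) d\<zeta> \<le> exp (\<gamma> s) \<Gamma>(q) / \<gamma>\<^bsup>q\<^esup>\<close>, the integral operator has Lipschitz constant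
  \<open>l\<^sub>\<psi> + l / \<gamma>\<^bsup>q\<^esup>\<close> for the Bielecki norm, which is below 1 for large \<open>\<gamma>\<close>; Banach's theorem then gives the
  unique solution (\<open>nonlocal_abel_equation_unique_solution\<close>).

  For the quasi-variational inequality, let \<open>S u\<close> be the solution of the variational inequality on the
  fixed set \<open>K u\<close>; the solutions sought are the fixed points of \<open>S\<close>. Three facts about a Lipschitz
  strongly pseudomonotone operator carry this part. A solution exists on every nonempty closed convex
  set (\<open>VI_solution_exists\<close>): by Minty's device a solution is a common point of a family of bounded
  closed convex sets, finite subfamilies of which meet by an elementary convex form of the KKM
  principle (\<open>KKM_convex\<close>), so that weak compactness applies (\<open>bounded_closed_convex_fip\<close>). The
  solution moves by at most \<open>\<delta> (1 + L / \<eta>)\<close> when the projections onto the constraint set move by at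
  most \<open>\<delta>\<close> (\<open>VI_set_stability\<close>); hence \<open>S\<close> has Lipschitz constant \<open>l\<^sub>K (1 + l\<^sub>G / \<eta>\<^sub>G)\<close>, and the last
  numerical hypothesis of the theorem forces this below 1. Finally the solution depends Lipschitz
  continuously on the operator (\<open>VI_operator_stability\<close>), which gives the regularity of \<open>U\<close>.

  The values lie in possibly non-separable Hilbert spaces. The Bochner integral is therefore handled
  by duality: once it is known to exist (\<open>bochner_integrable_dominated\<close>), its inner product with a
  fixed vector is an ordinary real integral (\<open>bochner_int_inner\<close>), and every estimate is made there.
\<close>

section \<open>Projections and weak compactness in Hilbert spaces\<close>

lemma Cauchy_if_norm_power2_le:
  fixes X :: "nat \<Rightarrow> 'b::real_normed_vector"
  assumes le: "\<And>m n. m \<le> n \<Longrightarrow> (norm (X n - X m))\<^sup>2 \<le> e m" and e: "e \<longlonglongrightarrow> 0"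
  shows "Cauchy X"
  unfolding Cauchy_altdef dist_norm
proof (intro allI impI)
  fix \<epsilon> :: real assume "\<epsilon> > 0"
  then have "\<forall>\<^sub>F m in sequentially. e m < \<epsilon>\<^sup>2"
    using e by (intro order_tendstoD) auto
  then obtain N where N: "\<And>m. m \<ge> N \<Longrightarrow> e m < \<epsilon>\<^sup>2"
    unfolding eventually_sequentially by blast
  have "norm (X m - X n) < \<epsilon>" if "m \<ge> N" "n > m" for m n
  proof -
    have "(norm (X n - X m))\<^sup>2 < \<epsilon>\<^sup>2"
      using le[of m n] N[of m] that by auto
    with \<open>\<epsilon> > 0\<close> show ?thesis
      by (simp add: power_less_imp_less_base norm_minus_commute)
  qed
  then show "\<exists>M. \<forall>m\<ge>M. \<forall>n>m. norm (X m - X n) < \<epsilon>"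
    by blast
qed

text \<open>
  By the parallelogram law, points of \<open>C\<close> whose distances to \<open>w\<close> are nearly minimal are close to each
  other, because their midpoint stays in \<open>C\<close>. So every minimizing sequence is Cauchy.
\<close>

lemma closest_point_exists_Hilbert:
  fixes C :: "'b::{real_inner,complete_space} set"
  assumes C: "convex C" "closed C" "C \<noteq> {}"
  obtains p where "p \<in> C" "\<forall>v\<in>C. dist w p \<le> dist w v"
proof -
  define d where "d = infdist w C"
  have "d \<ge> 0"
    by (simp add: d_def infdist_nonneg)
  have d_le: "d \<le> dist w v" if "v \<in> C" for v
    using that by (simp add: d_def infdist_le)
  have "\<exists>v\<in>C. (dist w v)\<^sup>2 < d\<^sup>2 + 1 / real (Suc n)" for n
  proof -
    have "d < sqrt (d\<^sup>2 + 1 / real (Suc n))"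
      by (rule real_less_rsqrt) simp
    then have "(INF v\<in>C. dist w v) < sqrt (d\<^sup>2 + 1 / real (Suc n))"
      using C by (simp add: d_def infdist_notempty)
    then obtain v where v: "v \<in> C" "dist w v < sqrt (d\<^sup>2 + 1 / real (Suc n))"
      using C by (auto dest!: cInf_lessD[rotated])
    have "0 \<le> d\<^sup>2 + 1 / real (Suc n)"
      by (intro add_nonneg_nonneg) auto
    then have "(dist w v)\<^sup>2 < d\<^sup>2 + 1 / real (Suc n)"
      using v(2) power_strict_mono[of "dist w v" "sqrt (d\<^sup>2 + 1 / real (Suc n))" 2] by simp
    with v(1) show ?thesis
      by blast
  qed
  then obtain X where X: "\<And>n. X n \<in> C" "\<And>n. (dist w (X n))\<^sup>2 < d\<^sup>2 + 1 / real (Suc n)"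
    by metis
  have "Cauchy X"
  proof (rule Cauchy_if_norm_power2_le)
    show "(norm (X n - X m))\<^sup>2 \<le> 4 * (1 / real (Suc m))" if "m \<le> n" for m n
    proof -
      have mid: "(1/2) *\<^sub>R X m + (1/2) *\<^sub>R X n \<in> C"
        using convexD[OF C(1) X(1) X(1), of "1/2" "1/2"] by simp
      have "(norm (X n - X m))\<^sup>2 = 2 * (dist w (X m))\<^sup>2 + 2 * (dist w (X n))\<^sup>2
          - 4 * (dist w ((1/2) *\<^sub>R X m + (1/2) *\<^sub>R X n))\<^sup>2"
        unfolding dist_norm power2_norm_eq_inner
        by (simp add: inner_diff inner_add algebra_simps inner_commute)
      moreover have "d\<^sup>2 \<le> (dist w ((1/2) *\<^sub>R X m + (1/2) *\<^sub>R X n))\<^sup>2"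
        using d_le[OF mid] \<open>d \<ge> 0\<close> by (intro power_mono) auto
      moreover have "1 / real (Suc n) \<le> 1 / real (Suc m)"
        using that by (simp add: frac_le)
      ultimately show ?thesis
        using X(2)[of m] X(2)[of n] by linarith
    qed
    show "(\<lambda>m. 4 * (1 / real (Suc m))) \<longlonglongrightarrow> 0"
      using tendsto_mult_right_zero[OF LIMSEQ_inverse_real_of_nat] by (simp add: divide_inverse)
  qed
  then obtain p where p: "X \<longlonglongrightarrow> p"
    using Cauchy_convergent_iff convergent_def by blast
  have "p \<in> C"
    using closed_sequentially[OF C(2) _ p] X(1) by blast
  moreover have "dist w p \<le> d"
  proof -
    have "(\<lambda>n. (dist w (X n))\<^sup>2) \<longlonglongrightarrow> (dist w p)\<^sup>2"
      by (intro tendsto_intros p)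
    moreover have "(\<lambda>n. d\<^sup>2 + 1 / real (Suc n)) \<longlonglongrightarrow> d\<^sup>2 + 0"
      using LIMSEQ_inverse_real_of_nat by (intro tendsto_intros) (simp add: divide_inverse)
    ultimately have "(dist w p)\<^sup>2 \<le> d\<^sup>2 + 0"
      by (rule LIMSEQ_le) (use X(2) less_imp_le in blast)
    then show ?thesis
      using \<open>d \<ge> 0\<close> power2_le_imp_le by force
  qed
  ultimately show ?thesis
    using d_le that by (meson order_trans)
qed

text \<open>
  The obtuse angle condition \<open>inner (w - p) (v - p) \<le> 0\<close> characterizes the projection. It is this
  form, rather than minimality, that connects projections with variational inequalities.
\<close>

lemma metric_projection_eqI:
  fixes C :: "'b::real_inner set"
  assumes "convex C" "closed C" "p \<in> C" and obtuse: "\<And>v. v \<in> C \<Longrightarrow> inner (w - p) (v - p) \<le> 0"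
  shows "metric_projection C w = p"
  unfolding metric_projection_def
proof (rule the_equality)
  have "dist w p \<le> dist w v" if "v \<in> C" for v
  proof -
    have "(dist w v)\<^sup>2 = (dist w p)\<^sup>2 + (norm (v - p))\<^sup>2 - 2 * inner (w - p) (v - p)"
      unfolding dist_norm power2_norm_eq_inner
      by (simp add: inner_diff inner_add algebra_simps inner_commute)
    then have "(dist w p)\<^sup>2 \<le> (dist w v)\<^sup>2"
      using obtuse[OF that] zero_le_power2[of "norm (v - p)"] by linarith
    then show ?thesis
      by (rule power2_le_imp_le) simp
  qed
  then show p: "p \<in> C \<and> (\<forall>v\<in>C. dist w p \<le> dist w v)"
    using \<open>p \<in> C\<close> by blast
  show "p' = p" if "p' \<in> C \<and> (\<forall>v\<in>C. dist w p' \<le> dist w v)" for p'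
    using any_closest_point_unique[OF assms(1,2)] that p by blast
qed

lemma
  fixes C :: "'b::{real_inner,complete_space} set"
  assumes C: "convex C" "closed C" "C \<noteq> {}"
  shows metric_projection_in: "metric_projection C w \<in> C"
    and metric_projection_obtuse:
      "v \<in> C \<Longrightarrow> inner (w - metric_projection C w) (v - metric_projection C w) \<le> 0"
proof -
  obtain p where p: "p \<in> C" "\<forall>v\<in>C. dist w p \<le> dist w v"
    using closest_point_exists_Hilbert[OF C] by blast
  have ob: "inner (w - p) (v - p) \<le> 0" if "v \<in> C" for v
    by (rule any_closest_point_dot[OF C(1,2) p(1) that p(2)])
  have "metric_projection C w = p"
    by (rule metric_projection_eqI[OF C(1,2) p(1) ob])
  with p ob show "metric_projection C w \<in> C"
    "v \<in> C \<Longrightarrow> inner (w - metric_projection C w) (v - metric_projection C w) \<le> 0"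
    by auto
qed

text \<open>
  Weak compactness of bounded closed convex sets, stated through the finite intersection property.
  Let \<open>p \<F>\<close> be the point of least norm of a finite intersection. Enlarging \<open>\<F>\<close> increases the norm
  of \<open>p \<F>\<close>, and moves \<open>p \<F>\<close> by a squared distance of at most the increase of the squared norm.
  Along a sequence of families whose norms approach the supremum \<open>r\<close> the points \<open>p \<F>\<close> thus converge, and
  adding any further member of the family moves them arbitrarily little, so the limit lies in it.
\<close>

lemma bounded_closed_convex_fip:
  fixes \<C> :: "'b::{real_inner,complete_space} set set"
  assumes cc: "\<And>A. A \<in> \<C> \<Longrightarrow> convex A \<and> closed A"
    and B: "B \<in> \<C>" "bounded B"
    and fip: "\<And>\<F>. finite \<F> \<Longrightarrow> \<F> \<subseteq> \<C> \<Longrightarrow> \<Inter>\<F> \<noteq> {}"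
  shows "\<Inter>\<C> \<noteq> {}"
proof -
  define \<FF> where "\<FF> = {\<F>. finite \<F> \<and> B \<in> \<F> \<and> \<F> \<subseteq> \<C>}"
  define p where "p \<F> = metric_projection (\<Inter>\<F>) 0" for \<F> :: "'b set set"
  have ccI: "convex (\<Inter>\<F>)" "closed (\<Inter>\<F>)" "\<Inter>\<F> \<noteq> {}" if "\<F> \<in> \<FF>" for \<F>
    using that cc fip by (auto simp: \<FF>_def intro!: convex_Inter closed_Inter)
  have p_in: "p \<F> \<in> \<Inter>\<F>" if "\<F> \<in> \<FF>" for \<F>
    unfolding p_def by (rule metric_projection_in[OF ccI[OF that]])
  have pyth: "(norm (p \<G> - p \<F>))\<^sup>2 \<le> (norm (p \<G>))\<^sup>2 - (norm (p \<F>))\<^sup>2"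
    if "\<F> \<in> \<FF>" "\<G> \<in> \<FF>" "\<F> \<subseteq> \<G>" for \<F> \<G>
  proof -
    have "p \<G> \<in> \<Inter>\<F>"
      using p_in[OF that(2)] that(3) by blast
    then have "inner (0 - p \<F>) (p \<G> - p \<F>) \<le> 0"
      unfolding p_def by (rule metric_projection_obtuse[OF ccI[OF that(1)]])
    then show ?thesis
      unfolding power2_norm_eq_inner by (simp add: inner_diff inner_commute)
  qed
  define r where "r = (SUP \<F>\<in>\<FF>. (norm (p \<F>))\<^sup>2)"
  have "{B} \<in> \<FF>"
    using B by (simp add: \<FF>_def)
  have bdd: "bdd_above ((\<lambda>\<F>. (norm (p \<F>))\<^sup>2) ` \<FF>)"
  proof -
    obtain R where R: "\<And>x. x \<in> B \<Longrightarrow> norm x \<le> R"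
      using B(2) bounded_iff by blast
    have "(norm (p \<F>))\<^sup>2 \<le> R\<^sup>2" if "\<F> \<in> \<FF>" for \<F>
      using p_in[OF that] R that by (intro power_mono) (auto simp: \<FF>_def)
    then show ?thesis
      by (auto intro!: bdd_aboveI)
  qed
  have le_r: "(norm (p \<F>))\<^sup>2 \<le> r" if "\<F> \<in> \<FF>" for \<F>
    unfolding r_def using cSUP_upper[OF that bdd] .
  have "\<exists>\<F>\<in>\<FF>. r - 1 / real (Suc n) < (norm (p \<F>))\<^sup>2" for n
    using less_cSUP_iff[OF _ bdd, of "r - 1 / real (Suc n)"] \<open>{B} \<in> \<FF>\<close>
    by (auto simp: r_def)
  then obtain H where H: "\<And>n. H n \<in> \<FF>" "\<And>n. r - 1 / real (Suc n) < (norm (p (H n)))\<^sup>2"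
    by metis
  define Q where "Q n = (\<Union>i\<le>n. H i)" for n
  have QF: "Q n \<in> \<FF>" for n
    using H(1) unfolding Q_def \<FF>_def by auto
  have Q_gt: "r - 1 / real (Suc n) < (norm (p (Q n)))\<^sup>2" for n
  proof -
    have "0 \<le> (norm (p (Q n) - p (H n)))\<^sup>2"
      by simp
    also have "\<dots> \<le> (norm (p (Q n)))\<^sup>2 - (norm (p (H n)))\<^sup>2"
      by (rule pyth[OF H(1) QF]) (auto simp: Q_def)
    finally show ?thesis
      using H(2)[of n] by linarith
  qed
  have near: "(norm (p \<G> - p (Q n)))\<^sup>2 \<le> 1 / real (Suc n)" if "\<G> \<in> \<FF>" "Q n \<subseteq> \<G>" for \<G> n
    using pyth[OF QF that] le_r[OF that(1)] Q_gt[of n] by linarith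
  have lim0: "(\<lambda>n. 1 / real (Suc n)) \<longlonglongrightarrow> 0"
    using LIMSEQ_inverse_real_of_nat by (simp add: divide_inverse)
  have "Cauchy (\<lambda>n. p (Q n))"
    by (rule Cauchy_if_norm_power2_le[OF near[OF QF] lim0]) (force simp: Q_def)
  then obtain x where x: "(\<lambda>n. p (Q n)) \<longlonglongrightarrow> x"
    using Cauchy_convergent_iff convergent_def by blast
  have "x \<in> A" if "A \<in> \<C>" for A
  proof -
    define y where "y n = p (insert A (Q n))" for n
    have ins: "insert A (Q n) \<in> \<FF>" for n
      using QF[of n] that by (auto simp: \<FF>_def)
    have "(\<lambda>n. (norm (y n - p (Q n)))\<^sup>2) \<longlonglongrightarrow> 0"
    proof (rule tendsto_sandwich[OF _ _ tendsto_const lim0])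
      show "\<forall>\<^sub>F n in sequentially. (norm (y n - p (Q n)))\<^sup>2 \<le> 1 / real (Suc n)"
        unfolding y_def by (intro always_eventually allI near[OF ins]) blast
    qed simp
    then have "(\<lambda>n. y n - p (Q n)) \<longlonglongrightarrow> 0"
      by (simp add: tendsto_norm_zero_iff)
    then have "y \<longlonglongrightarrow> x"
      using tendsto_add[OF _ x, of "\<lambda>n. y n - p (Q n)" 0] by simp
    moreover have "y n \<in> A" for n
      using p_in[OF ins] by (auto simp: y_def)
    ultimately show ?thesis
      using cc[OF that] closed_sequentially by blast
  qed
  then show ?thesis
    by blast
qed

section \<open>Intersections of convex sets\<close>

lemma compact_convex_strict_separation:
  fixes A B :: "'b::real_inner set"
  assumes A: "compact A" "convex A" "A \<noteq> {}" and B: "compact B" "convex B" "B \<noteq> {}"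
    and disj: "A \<inter> B = {}"
  obtains a m where "\<And>x. x \<in> A \<Longrightarrow> m < inner a x" "\<And>x. x \<in> B \<Longrightarrow> inner a x < m"
proof -
  have "\<exists>z\<in>A \<times> B. \<forall>z'\<in>A \<times> B. dist (fst z) (snd z) \<le> dist (fst z') (snd z')"
    using A B by (intro continuous_attains_inf compact_Times continuous_intros) auto
  then obtain p q where pq: "p \<in> A" "q \<in> B" and min: "\<And>x y. x \<in> A \<Longrightarrow> y \<in> B \<Longrightarrow> dist p q \<le> dist x y"
    by auto
  define a where "a = p - q"
  have "p \<noteq> q"
    using pq disj by blast
  then have "0 < inner a a"
    by (simp add: a_def)
  then have gap: "inner a q < inner a p"
    by (simp add: a_def inner_diff)
  have p_min: "inner a p \<le> inner a x" if "x \<in> A" for x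
    using any_closest_point_dot[OF A(2) compact_imp_closed[OF A(1)] pq(1) that, of q] min[OF _ pq(2)]
    by (simp add: a_def inner_diff dist_commute algebra_simps inner_commute)
  have q_max: "inner a y \<le> inner a q" if "y \<in> B" for y
    using any_closest_point_dot[OF B(2) compact_imp_closed[OF B(1)] pq(2) that, of p] min[OF pq(1)]
    by (simp add: a_def inner_diff dist_commute algebra_simps inner_commute)
  show ?thesis
  proof (rule that[of "(inner a p + inner a q) / 2" a])
    show "(inner a p + inner a q) / 2 < inner a x" if "x \<in> A" for x
      using p_min[OF that] gap by simp
    show "inner a x < (inner a p + inner a q) / 2" if "x \<in> B" for x
      using q_max[OF that] gap by simp
  qed
qed

text \<open>
  Klee's theorem: if closed convex sets cover a compact convex set \<open>D\<close> and all but any one of them meet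
  within \<open>D\<close>, then all of them do. Otherwise a hyperplane \<open>H\<close> strictly separates \<open>A n\<close> from the
  intersection \<open>P\<close> of the others. On \<open>D \<inter> H\<close> the set \<open>A n\<close> is absent, and segments from \<open>P\<close> to
  \<open>A n\<close> show that the remaining sets still satisfy the hypotheses there; by induction they meet on
  \<open>H\<close>, although \<open>P\<close> misses \<open>H\<close>. The set \<open>D\<close> is a separate parameter so that it can be
  cut down while the family stays the same.
\<close>

lemma Klee_intersection:
  fixes A :: "'i \<Rightarrow> 'b::real_inner set"
  assumes "finite I" "I \<noteq> {}"
    and "compact D" "convex D" "D \<subseteq> (\<Union>i\<in>I. A i)"
    and "\<And>i. i \<in> I \<Longrightarrow> convex (A i) \<and> closed (A i)"
    and "\<And>j. j \<in> I \<Longrightarrow> D \<inter> (\<Inter>i\<in>I - {j}. A i) \<noteq> {}"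
  shows "D \<inter> (\<Inter>i\<in>I. A i) \<noteq> {}"
  using assms
proof (induction I arbitrary: D rule: finite_ne_induct)
  case (singleton n)
  then show ?case by auto
next
  case (insert n I)
  show ?case
  proof
    assume emp: "D \<inter> (\<Inter>i\<in>insert n I. A i) = {}"
    define P where "P = D \<inter> (\<Inter>i\<in>I. A i)"
    have Icc: "closed (\<Inter>i\<in>J. A i)" "convex (\<Inter>i\<in>J. A i)" if "J \<subseteq> insert n I" for J
      using insert.prems(4) that by (auto intro!: closed_INT convex_INT)
    have "P \<noteq> {}"
      using insert.prems(5)[of n] insert.hyps by (simp add: P_def insert_Diff_if)
    moreover have "compact P" "convex P"
      unfolding P_def using insert.prems(1,2) Icc[of I]
      by (auto intro!: compact_Int_closed convex_Int)
    moreover have "D \<inter> A n \<noteq> {}"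
    proof -
      obtain j where "j \<in> I"
        using insert.hyps by blast
      then show ?thesis
        using insert.prems(5)[of j] insert.hyps by auto
    qed
    moreover have "compact (D \<inter> A n)" "convex (D \<inter> A n)"
      using insert.prems(1,2,4) by (auto intro!: compact_Int_closed convex_Int)
    moreover have "P \<inter> (D \<inter> A n) = {}"
      using emp by (auto simp: P_def)
    ultimately obtain a m where above: "\<And>x. x \<in> P \<Longrightarrow> m < inner a x"
      and below: "\<And>x. x \<in> D \<inter> A n \<Longrightarrow> inner a x < m"
      using compact_convex_strict_separation[of P "D \<inter> A n"] by metis
    define H where "H = {x. inner a x = m}"
    have "(D \<inter> H) \<inter> (\<Inter>i\<in>I. A i) \<noteq> {}"
    proof (rule insert.IH)
      show "compact (D \<inter> H)" "convex (D \<inter> H)"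
        using insert.prems(1,2) unfolding H_def
        by (auto intro!: compact_Int_closed convex_Int closed_hyperplane convex_hyperplane)
      show "D \<inter> H \<subseteq> (\<Union>i\<in>I. A i)"
        using insert.prems(3) below by (force simp: H_def)
      show "convex (A i) \<and> closed (A i)" if "i \<in> I" for i
        using insert.prems(4) that by blast
      show "(D \<inter> H) \<inter> (\<Inter>i\<in>I - {j}. A i) \<noteq> {}" if j: "j \<in> I" for j
      proof -
        define W where "W = D \<inter> (\<Inter>i\<in>I - {j}. A i)"
        have "convex W"
          unfolding W_def using insert.prems(2) Icc[of "I - {j}"] by (auto intro!: convex_Int)
        obtain x where x: "x \<in> P"
          using \<open>P \<noteq> {}\<close> by blast
        obtain y where y: "y \<in> D" "y \<in> (\<Inter>i\<in>insert n I - {j}. A i)"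
          using insert.prems(5)[of j] j by blast
        have ynA: "y \<in> D \<inter> A n"
          using y j insert.hyps by auto
        have xy: "x \<in> W" "y \<in> W"
          using x y by (auto simp: W_def P_def)
        define t where "t = (inner a x - m) / (inner a x - inner a y)"
        have gap: "inner a y < m" "m < inner a x"
          using above[OF x] below[OF ynA] by auto
        then have t: "0 \<le> t" "t \<le> 1"
          by (auto simp: t_def divide_simps)
        have "(1 - t) *\<^sub>R x + t *\<^sub>R y \<in> W"
          using \<open>convex W\<close> xy t by (simp add: convex_alt)
        moreover have "inner a ((1 - t) *\<^sub>R x + t *\<^sub>R y) = inner a x - t * (inner a x - inner a y)"
          by (simp add: inner_add algebra_simps)
        then have "inner a ((1 - t) *\<^sub>R x + t *\<^sub>R y) = m"
          using gap by (simp add: t_def)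
        ultimately show ?thesis
          unfolding W_def H_def by blast
      qed
    qed
    then obtain x where "x \<in> P" "inner a x = m"
      unfolding P_def H_def by blast
    then show False
      using above by force
  qed
qed

text \<open>
  The Knaster--Kuratowski--Mazurkiewicz principle for convex sets \<open>M y\<close>. Convexity lets Klee's theorem
  replace Brouwer's or Sperner's, which keeps the argument independent of dimension: by induction all
  sets but one meet on a face of the hull.
\<close>

lemma KKM_convex:
  fixes M :: "'b::real_inner \<Rightarrow> 'b set"
  assumes "finite Y" "Y \<noteq> {}"
    and "\<And>y. y \<in> Y \<Longrightarrow> convex (M y) \<and> closed (M y)"
    and "\<And>J. J \<subseteq> Y \<Longrightarrow> convex hull J \<subseteq> (\<Union>y\<in>J. M y)"
  shows "convex hull Y \<inter> (\<Inter>y\<in>Y. M y) \<noteq> {}"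
  using assms
proof (induction Y rule: finite_psubset_induct)
  case (psubset Y)
  show ?case
  proof (rule Klee_intersection)
    show "convex hull Y \<subseteq> (\<Union>y\<in>Y. M y)"
      using psubset.prems(3) by blast
    show "convex hull Y \<inter> (\<Inter>i\<in>Y - {j}. M i) \<noteq> {}" if "j \<in> Y" for j
    proof (cases "Y - {j} = {}")
      case True
      show ?thesis
        unfolding True using psubset.prems(1) by simp
    next
      case False
      have "convex hull (Y - {j}) \<inter> (\<Inter>i\<in>Y - {j}. M i) \<noteq> {}"
        using psubset.prems(2,3) that False by (intro psubset.IH) auto
      then show ?thesis
        using hull_mono[of "Y - {j}" Y convex] by blast
    qed
    show "compact (convex hull Y)"
      by (rule finite_imp_compact_convex_hull[OF psubset.hyps(1)])
  qed (use psubset.hyps psubset.prems in auto)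
qed

section \<open>Strongly pseudomonotone variational inequalities\<close>

definition VI :: "'b::real_inner set \<Rightarrow> ('b \<Rightarrow> 'b) \<Rightarrow> 'b set" where
  "VI C F = {w \<in> C. \<forall>v\<in>C. inner (F w) (v - w) \<ge> 0}"

definition strongly_pseudomonotone :: "real \<Rightarrow> 'b::real_inner set \<Rightarrow> ('b \<Rightarrow> 'b) \<Rightarrow> bool" where
  "strongly_pseudomonotone \<eta> C F \<longleftrightarrow>
     (\<forall>u\<^sub>1\<in>C. \<forall>u\<^sub>2\<in>C. inner (F u\<^sub>2) (u\<^sub>1 - u\<^sub>2) \<ge> 0 \<longrightarrow>
        inner (F u\<^sub>1) (u\<^sub>1 - u\<^sub>2) \<ge> \<eta> * (norm (u\<^sub>1 - u\<^sub>2))\<^sup>2)"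

text \<open>
  For strongly pseudomonotone \<open>F\<close> a solution \<open>w\<close> satisfies
  \<open>\<eta> * (norm (y - w))\<^sup>2 \<le> inner (F y) (y - w)\<close> for all \<open>y\<close> in \<open>C\<close>. For fixed \<open>y\<close> this condition
  describes a ball, so it defines a bounded closed convex set \<open>M y\<close>. Pseudomonotonicity gives the KKM
  covering property of the sets \<open>M y\<close>, hence a common point; and a common point solves the
  inequality, as one sees by testing with \<open>y = w + t *\<^sub>R (v - w)\<close> and letting \<open>t\<close> tend to 0.
\<close>

lemma VI_solution_exists:
  fixes C :: "'b::{real_inner,complete_space} set"
  assumes C: "convex C" "closed C" "C \<noteq> {}" and cont: "continuous_on C F"
    and pseudo: "strongly_pseudomonotone \<eta> C F" and "\<eta> > 0"
  obtains w where "w \<in> VI C F"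
proof -
  define M where "M y = C \<inter> cball (y - (1 / (2 * \<eta>)) *\<^sub>R F y) (norm (F y) / (2 * \<eta>))" for y
  \<comment> \<open>Completing the square: the ball consists of the points that satisfy the strengthened Minty inequality.\<close>
  have M_iff: "w \<in> M y \<longleftrightarrow> w \<in> C \<and> \<eta> * (norm (y - w))\<^sup>2 \<le> inner (F y) (y - w)" for w y
  proof -
    have sq: "(dist (y - (1 / (2 * \<eta>)) *\<^sub>R F y) w)\<^sup>2
        = (norm (y - w))\<^sup>2 - inner (F y) (y - w) / \<eta> + (norm (F y) / (2 * \<eta>))\<^sup>2"
      using \<open>\<eta> > 0\<close> unfolding dist_norm power_divide power2_norm_eq_inner
      by (simp add: inner_diff inner_add inner_commute field_simps power2_eq_square)
    have "dist (y - (1 / (2 * \<eta>)) *\<^sub>R F y) w \<le> norm (F y) / (2 * \<eta>) \<longleftrightarrow>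
        (dist (y - (1 / (2 * \<eta>)) *\<^sub>R F y) w)\<^sup>2 \<le> (norm (F y) / (2 * \<eta>))\<^sup>2"
      using \<open>\<eta> > 0\<close> by (simp add: power_mono_iff)
    also have "\<dots> \<longleftrightarrow> \<eta> * (norm (y - w))\<^sup>2 \<le> inner (F y) (y - w)"
      using \<open>\<eta> > 0\<close> unfolding sq by (simp add: pos_le_divide_eq mult.commute)
    finally show ?thesis
      by (simp add: M_def)
  qed
  have M: "convex (M y)" "closed (M y)" "bounded (M y)" for y
    using C by (auto simp: M_def convex_Int closed_Int bounded_Int)
  \<comment> \<open>If \<open>x\<close> were in no \<open>M y\<close>, then all \<open>y\<close> in \<open>J\<close> would lie strictly on one side of the hyperplane
    through \<open>x\<close> with normal \<open>F x\<close>, and \<open>x\<close> could not be in their hull.\<close>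
  have KKM: "convex hull J \<subseteq> (\<Union>y\<in>J. M y)" if "J \<subseteq> C" for J
  proof
    fix x assume x: "x \<in> convex hull J"
    then have "x \<in> C"
      using hull_minimal[of J C convex, OF that C(1)] by (rule subsetD[rotated])
    show "x \<in> (\<Union>y\<in>J. M y)"
    proof (rule ccontr)
      assume uncovered: "x \<notin> (\<Union>y\<in>J. M y)"
      have "inner (F x) (y - x) < 0" if "y \<in> J" for y
      proof (rule ccontr)
        assume "\<not> inner (F x) (y - x) < 0"
        moreover have "y \<in> C"
          using that \<open>J \<subseteq> C\<close> by blast
        ultimately have "\<eta> * (norm (y - x))\<^sup>2 \<le> inner (F y) (y - x)"
          using pseudo \<open>x \<in> C\<close> unfolding strongly_pseudomonotone_def by (simp add: not_less)
        then show False
          using uncovered \<open>x \<in> C\<close> that M_iff by blast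
      qed
      then have "J \<subseteq> {y. inner (F x) y < inner (F x) x}"
        by (auto simp: inner_diff)
      then have "convex hull J \<subseteq> {y. inner (F x) y < inner (F x) x}"
        by (intro hull_minimal convex_halfspace_lt)
      with x show False
        by auto
    qed
  qed
  obtain y\<^sub>0 where "y\<^sub>0 \<in> C"
    using C(3) by blast
  have "\<Inter>(M ` C) \<noteq> {}"
  proof (rule bounded_closed_convex_fip)
    show "M y\<^sub>0 \<in> M ` C" "bounded (M y\<^sub>0)"
      using \<open>y\<^sub>0 \<in> C\<close> M by auto
    show "convex A \<and> closed A" if "A \<in> M ` C" for A
      using that M by auto
    show "\<Inter>\<F> \<noteq> {}" if \<F>: "finite \<F>" "\<F> \<subseteq> M ` C" for \<F>
    proof (cases "\<F> = {}")
      case False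
      obtain Y where Y: "Y \<subseteq> C" "finite Y" "\<F> = M ` Y"
        using finite_subset_image[OF \<F>] by metis
      have "convex hull Y \<inter> (\<Inter>y\<in>Y. M y) \<noteq> {}"
        using Y False M KKM by (intro KKM_convex) auto
      then show ?thesis
        using Y by blast
    qed auto
  qed
  then obtain w where w: "\<And>y. y \<in> C \<Longrightarrow> w \<in> M y"
    by blast
  have "w \<in> C"
    using w[OF \<open>y\<^sub>0 \<in> C\<close>] M_iff by blast
  have "inner (F w) (v - w) \<ge> 0" if "v \<in> C" for v
  proof -
    define t where "t n = inverse (real (Suc n))" for n
    define y where "y n = w + t n *\<^sub>R (v - w)" for n
    have t: "0 < t n" "t n \<le> 1" for n
      by (auto simp: t_def divide_simps)
    have yC: "y n \<in> C" for n
    proof -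
      have "y n = (1 - t n) *\<^sub>R w + t n *\<^sub>R v"
        by (simp add: y_def algebra_simps)
      then show ?thesis
        using C(1) \<open>w \<in> C\<close> that t[of n] by (simp add: convex_alt)
    qed
    have "t \<longlonglongrightarrow> 0"
      unfolding t_def by (rule LIMSEQ_inverse_real_of_nat)
    then have "y \<longlonglongrightarrow> w + 0 *\<^sub>R (v - w)"
      unfolding y_def by (intro tendsto_intros)
    then have "(\<lambda>n. F (y n)) \<longlonglongrightarrow> F w"
      using cont \<open>w \<in> C\<close> yC by (intro continuous_on_tendsto_compose[OF cont]) auto
    then have lim: "(\<lambda>n. inner (F (y n)) (v - w)) \<longlonglongrightarrow> inner (F w) (v - w)"
      by (intro tendsto_intros)
    have "0 \<le> inner (F (y n)) (v - w)" for n
    proof -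
      have "0 \<le> \<eta> * (norm (y n - w))\<^sup>2"
        using \<open>\<eta> > 0\<close> by simp
      also have "\<dots> \<le> inner (F (y n)) (y n - w)"
        using w[OF yC] M_iff by blast
      also have "\<dots> = t n * inner (F (y n)) (v - w)"
        by (simp add: y_def)
      finally show ?thesis
        using t[of n] by (simp add: zero_le_mult_iff)
    qed
    then show ?thesis
      by (intro LIMSEQ_le_const[OF lim]) blast
  qed
  with \<open>w \<in> C\<close> show ?thesis
    by (intro that) (auto simp: VI_def)
qed

lemma VI_operator_stability:
  assumes w\<^sub>1: "w\<^sub>1 \<in> VI C F\<^sub>1" and w\<^sub>2: "w\<^sub>2 \<in> VI C F\<^sub>2"
    and pseudo: "strongly_pseudomonotone \<eta> C F\<^sub>1" and "\<eta> > 0"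
  shows "norm (w\<^sub>1 - w\<^sub>2) \<le> norm (F\<^sub>1 w\<^sub>2 - F\<^sub>2 w\<^sub>2) / \<eta>"
proof -
  have "\<eta> * (norm (w\<^sub>2 - w\<^sub>1))\<^sup>2 \<le> inner (F\<^sub>1 w\<^sub>2) (w\<^sub>2 - w\<^sub>1)"
    using assms by (auto simp: VI_def strongly_pseudomonotone_def)
  also have "\<dots> \<le> inner (F\<^sub>1 w\<^sub>2 - F\<^sub>2 w\<^sub>2) (w\<^sub>2 - w\<^sub>1)"
    using w\<^sub>1 w\<^sub>2 by (auto simp: VI_def inner_diff)
  also have "\<dots> \<le> norm (F\<^sub>1 w\<^sub>2 - F\<^sub>2 w\<^sub>2) * norm (w\<^sub>2 - w\<^sub>1)"
    by (rule norm_cauchy_schwarz)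
  finally have "(\<eta> * norm (w\<^sub>2 - w\<^sub>1)) * norm (w\<^sub>2 - w\<^sub>1) \<le> norm (F\<^sub>1 w\<^sub>2 - F\<^sub>2 w\<^sub>2) * norm (w\<^sub>2 - w\<^sub>1)"
    by (simp add: power2_eq_square mult.assoc)
  then have "\<eta> * norm (w\<^sub>2 - w\<^sub>1) \<le> norm (F\<^sub>1 w\<^sub>2 - F\<^sub>2 w\<^sub>2)"
    by (cases "w\<^sub>1 = w\<^sub>2") auto
  then show ?thesis
    using \<open>\<eta> > 0\<close> by (simp add: field_simps norm_minus_commute)
qed

text \<open>
  For every \<open>\<epsilon> > 0\<close> the solution \<open>w\<^sub>2\<close> is the projection onto \<open>C\<^sub>2\<close> of \<open>z = w\<^sub>2 - (1 / \<epsilon>) *\<^sub>R F w\<^sub>2\<close>.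
  The projection \<open>p\<close> of the same \<open>z\<close> onto \<open>C\<^sub>1\<close> is within \<open>\<delta>\<close> of \<open>w\<^sub>2\<close>, and its obtuse angle condition
  makes it an approximate solution on \<open>C\<^sub>1\<close>. Strong pseudomonotonicity on \<open>C\<^sub>1\<close> alone then bounds the
  distance from \<open>p\<close> to \<open>w\<^sub>1\<close>. The step length \<open>1 / \<epsilon>\<close> is free, and sending it to infinity gives the
  best constant.
\<close>

lemma VI_set_stability:
  fixes C\<^sub>1 C\<^sub>2 :: "'b::{real_inner,complete_space} set"
  assumes C\<^sub>1: "convex C\<^sub>1" "closed C\<^sub>1" "C\<^sub>1 \<noteq> {}" and C\<^sub>2: "convex C\<^sub>2" "closed C\<^sub>2"
    and w\<^sub>1: "w\<^sub>1 \<in> VI C\<^sub>1 F" and w\<^sub>2: "w\<^sub>2 \<in> VI C\<^sub>2 F"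
    and pseudo: "strongly_pseudomonotone \<eta> C\<^sub>1 F" and "\<eta> > 0"
    and lip: "\<And>u v. u \<in> C\<^sub>1 \<Longrightarrow> v \<in> C\<^sub>2 \<Longrightarrow> norm (F u - F v) \<le> L * norm (u - v)" and "L \<ge> 0"
    and proj: "\<And>z. norm (metric_projection C\<^sub>1 z - metric_projection C\<^sub>2 z) \<le> \<delta>"
  shows "norm (w\<^sub>1 - w\<^sub>2) \<le> \<delta> * (1 + L / \<eta>)"
proof -
  have "\<delta> \<ge> 0"
    using proj[of 0] norm_ge_zero order_trans by blast
  have bound: "norm (w\<^sub>1 - w\<^sub>2) \<le> \<delta> * (1 + (\<epsilon> + L) / \<eta>)" if "\<epsilon> > 0" for \<epsilon>
  proof -
    define z where "z = w\<^sub>2 - (1 / \<epsilon>) *\<^sub>R F w\<^sub>2"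
    define p where "p = metric_projection C\<^sub>1 z"
    have "metric_projection C\<^sub>2 z = w\<^sub>2"
      using w\<^sub>2 \<open>\<epsilon> > 0\<close> by (intro metric_projection_eqI[OF C\<^sub>2]) (auto simp: z_def VI_def)
    then have p_w2: "norm (p - w\<^sub>2) \<le> \<delta>"
      using proj[of z] by (simp add: p_def)
    have pC: "p \<in> C\<^sub>1"
      unfolding p_def by (rule metric_projection_in[OF C\<^sub>1])
    have "inner (z - p) (w\<^sub>1 - p) \<le> 0"
      unfolding p_def using w\<^sub>1 by (intro metric_projection_obtuse[OF C\<^sub>1]) (auto simp: VI_def)
    then have "(1 / \<epsilon>) * inner (F w\<^sub>2) (p - w\<^sub>1) \<le> inner (w\<^sub>2 - p) (p - w\<^sub>1)"
      by (simp add: z_def inner_diff algebra_simps inner_commute)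
    then have "inner (F w\<^sub>2) (p - w\<^sub>1) \<le> \<epsilon> * inner (w\<^sub>2 - p) (p - w\<^sub>1)"
      using \<open>\<epsilon> > 0\<close> by (simp add: field_simps)
    also have "\<dots> \<le> \<epsilon> * (norm (p - w\<^sub>2) * norm (p - w\<^sub>1))"
      using norm_cauchy_schwarz[of "w\<^sub>2 - p" "p - w\<^sub>1"] \<open>\<epsilon> > 0\<close> by (simp add: norm_minus_commute)
    finally have 1: "inner (F w\<^sub>2) (p - w\<^sub>1) \<le> \<epsilon> * (norm (p - w\<^sub>2) * norm (p - w\<^sub>1))" .
    have "inner (F p - F w\<^sub>2) (p - w\<^sub>1) \<le> norm (F p - F w\<^sub>2) * norm (p - w\<^sub>1)"
      by (rule norm_cauchy_schwarz)
    also have "\<dots> \<le> L * norm (p - w\<^sub>2) * norm (p - w\<^sub>1)"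
      using lip[OF pC] w\<^sub>2 by (intro mult_right_mono) (auto simp: VI_def)
    finally have 2: "inner (F p - F w\<^sub>2) (p - w\<^sub>1) \<le> L * norm (p - w\<^sub>2) * norm (p - w\<^sub>1)" .
    have "\<eta> * (norm (p - w\<^sub>1))\<^sup>2 \<le> inner (F p) (p - w\<^sub>1)"
      using w\<^sub>1 pseudo pC by (auto simp: VI_def strongly_pseudomonotone_def)
    also have "\<dots> \<le> (\<epsilon> + L) * norm (p - w\<^sub>2) * norm (p - w\<^sub>1)"
      using 1 2 by (simp add: inner_diff algebra_simps)
    finally have "(\<eta> * norm (p - w\<^sub>1)) * norm (p - w\<^sub>1) \<le> ((\<epsilon> + L) * norm (p - w\<^sub>2)) * norm (p - w\<^sub>1)"
      by (simp add: power2_eq_square mult.assoc)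
    then have "\<eta> * norm (p - w\<^sub>1) \<le> (\<epsilon> + L) * norm (p - w\<^sub>2)"
      using \<open>\<epsilon> > 0\<close> \<open>L \<ge> 0\<close> by (cases "p = w\<^sub>1") auto
    also have "\<dots> \<le> (\<epsilon> + L) * \<delta>"
      using p_w2 \<open>\<epsilon> > 0\<close> \<open>L \<ge> 0\<close> by (intro mult_left_mono) auto
    finally have "norm (p - w\<^sub>1) \<le> (\<epsilon> + L) * \<delta> / \<eta>"
      using \<open>\<eta> > 0\<close> by (simp add: field_simps)
    moreover have "norm (w\<^sub>1 - w\<^sub>2) \<le> norm (p - w\<^sub>1) + norm (p - w\<^sub>2)"
      using norm_triangle_ineq4[of "p - w\<^sub>2" "p - w\<^sub>1"] by (simp add: norm_minus_commute)
    ultimately show ?thesis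
      using p_w2 by (simp add: algebra_simps)
  qed
  have lim: "((\<lambda>\<epsilon>. \<delta> * (1 + (\<epsilon> + L) / \<eta>)) \<longlongrightarrow> \<delta> * (1 + (0 + L) / \<eta>)) (at_right 0)"
    using \<open>\<eta> > 0\<close> by (intro tendsto_intros) auto
  have "norm (w\<^sub>1 - w\<^sub>2) \<le> \<delta> * (1 + (0 + L) / \<eta>)"
    by (rule tendsto_lowerbound[OF lim]) (use bound in \<open>auto simp: eventually_at_right_less eventually_at_filter\<close>)
  then show ?thesis
    by simp
qed

section \<open>Quasi-variational inequalities\<close>

text \<open>
  The smallness condition amounts to \<open>k\<^sup>2 * c < \<eta>\<^sup>2\<close> for a number \<open>c\<close> that is at least
  \<open>8 * L\<^sup>2 + 2 * \<eta>\<^sup>2\<close>, and so dominates \<open>(\<eta> + L)\<^sup>2\<close>.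
\<close>

lemma qvi_contraction_constant:
  fixes \<eta> L k :: real
  assumes "\<eta> > 0" "L > 0" "k \<ge> 0"
    and small: "2 * (k\<^sup>2 / \<eta>\<^sup>2) * (L * sqrt (4 * L\<^sup>2 + 2 * \<eta>\<^sup>2) + 2 * L\<^sup>2 + \<eta>\<^sup>2) < 1"
  shows "k * (1 + L / \<eta>) < 1"
proof -
  have "2 * L\<^sup>2 = L * sqrt (4 * L\<^sup>2)"
    using \<open>L > 0\<close> by (simp add: real_sqrt_mult power2_eq_square)
  also have "\<dots> \<le> L * sqrt (4 * L\<^sup>2 + 2 * \<eta>\<^sup>2)"
    using \<open>L > 0\<close> by simp
  finally have "(\<eta> + L)\<^sup>2 \<le> 2 * (L * sqrt (4 * L\<^sup>2 + 2 * \<eta>\<^sup>2) + 2 * L\<^sup>2 + \<eta>\<^sup>2)"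
    using sum_squares_bound[of \<eta> L] by (simp add: power2_sum) (smt (verit) zero_le_power2)
  then have "(k\<^sup>2 / \<eta>\<^sup>2) * (\<eta> + L)\<^sup>2
      \<le> (k\<^sup>2 / \<eta>\<^sup>2) * (2 * (L * sqrt (4 * L\<^sup>2 + 2 * \<eta>\<^sup>2) + 2 * L\<^sup>2 + \<eta>\<^sup>2))"
    by (intro mult_left_mono) auto
  also have "\<dots> < 1"
    using small by (simp add: algebra_simps)
  also have "(k\<^sup>2 / \<eta>\<^sup>2) * (\<eta> + L)\<^sup>2 = (k * (1 + L / \<eta>))\<^sup>2"
    using \<open>\<eta> > 0\<close> by (simp add: power2_eq_square field_simps)
  finally have "(k * (1 + L / \<eta>))\<^sup>2 < 1\<^sup>2"
    by simp
  then show ?thesis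
    by (rule power_less_imp_less_base) simp
qed

lemma SOL_iff_VI: "w \<in> SOL \<Omega> K F \<longleftrightarrow> w \<in> \<Omega> \<and> w \<in> VI (K w) F"
  by (auto simp: SOL_def VI_def)

text \<open>
  The moving constraint set, with \<open>k\<close> the Lipschitz constant of its projections. The constants \<open>L\<close> and
  \<open>\<eta>\<close> are those of the operators admitted below; \<open>k * (1 + L / \<eta>)\<close> is a Lipschitz constant, common
  to all of them, of the map from \<open>u\<close> to the solution on the fixed set \<open>K u\<close>.
\<close>

locale qvi_constraints =
  fixes \<Omega> :: "'b::{real_inner,complete_space} set" and K :: "'b \<Rightarrow> 'b set" and k \<eta> L :: real
  assumes \<Omega>: "closed \<Omega>" "\<Omega> \<noteq> {}"
    and K: "u \<in> \<Omega> \<Longrightarrow> K u \<subseteq> \<Omega>" "u \<in> \<Omega> \<Longrightarrow> K u \<noteq> {}" "u \<in> \<Omega> \<Longrightarrow> closed (K u)" "u \<in> \<Omega> \<Longrightarrow> convex (K u)"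
    and K_lipschitz: "u \<in> \<Omega> \<Longrightarrow> v \<in> \<Omega> \<Longrightarrow>
      norm (metric_projection (K u) z - metric_projection (K v) z) \<le> k * norm (u - v)"
    and constants: "\<eta> > 0" "L \<ge> 0" "k \<ge> 0" "k * (1 + L / \<eta>) < 1"
begin

definition admissible :: "('b \<Rightarrow> 'b) \<Rightarrow> bool" where
  "admissible F \<longleftrightarrow> (\<forall>u\<in>\<Omega>. \<forall>v\<in>\<Omega>. norm (F u - F v) \<le> L * norm (u - v)) \<and>
     (\<forall>u\<in>\<Omega>. strongly_pseudomonotone \<eta> (K u) F)"

lemma VI_stability_in_constraint:
  assumes F: "admissible F" and uv: "u \<in> \<Omega>" "v \<in> \<Omega>" and w: "w \<in> VI (K u) F" "w' \<in> VI (K v) F"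
  shows "norm (w - w') \<le> k * (1 + L / \<eta>) * norm (u - v)"
proof -
  have "norm (w - w') \<le> (k * norm (u - v)) * (1 + L / \<eta>)"
  proof (rule VI_set_stability[OF _ _ _ _ _ w])
    show "norm (F a - F b) \<le> L * norm (a - b)" if "a \<in> K u" "b \<in> K v" for a b
      using F K(1) uv that unfolding admissible_def by blast
    show "strongly_pseudomonotone \<eta> (K u) F"
      using F uv unfolding admissible_def by blast
  qed (use uv K K_lipschitz constants in auto)
  then show ?thesis
    by (simp add: algebra_simps)
qed

lemma VI_exists:
  assumes F: "admissible F" and u: "u \<in> \<Omega>"
  obtains w where "w \<in> VI (K u) F"
proof -
  have lip: "norm (F a - F b) \<le> L * norm (a - b)" if "a \<in> K u" "b \<in> K u" for a b
    using F K(1)[OF u] that unfolding admissible_def by blast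
  have "continuous_on (K u) F"
    by (rule lipschitz_on_continuous_on[of L])
      (use lip constants in \<open>auto simp: lipschitz_on_def dist_norm\<close>)
  then show ?thesis
    using VI_solution_exists[OF K(4,3,2)[OF u]] F u constants that unfolding admissible_def by blast
qed

text \<open>
  Uniqueness and Lipschitz dependence at once. The change from \<open>w\<^sub>1\<close> to \<open>w\<^sub>2\<close> is split at the solution \<open>v\<close>
  for the operator \<open>F\<^sub>1\<close> on the set \<open>K w\<^sub>2\<close>; the first part is absorbed by the contraction.
\<close>

lemma SOL_stability:
  assumes F: "admissible F\<^sub>1" and w\<^sub>1: "w\<^sub>1 \<in> SOL \<Omega> K F\<^sub>1" and w\<^sub>2: "w\<^sub>2 \<in> SOL \<Omega> K F\<^sub>2"
  shows "norm (w\<^sub>1 - w\<^sub>2) \<le> norm (F\<^sub>1 w\<^sub>2 - F\<^sub>2 w\<^sub>2) / (\<eta> * (1 - k * (1 + L / \<eta>)))"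
proof -
  obtain v where v: "v \<in> VI (K w\<^sub>2) F\<^sub>1"
    using VI_exists[OF F] w\<^sub>2 by (auto simp: SOL_iff_VI)
  have "norm (w\<^sub>1 - v) \<le> k * (1 + L / \<eta>) * norm (w\<^sub>1 - w\<^sub>2)"
    using w\<^sub>1 w\<^sub>2 by (intro VI_stability_in_constraint[OF F _ _ _ v]) (auto simp: SOL_iff_VI)
  moreover have "norm (v - w\<^sub>2) \<le> norm (F\<^sub>1 w\<^sub>2 - F\<^sub>2 w\<^sub>2) / \<eta>"
    using F w\<^sub>2 constants
    by (intro VI_operator_stability[OF v]) (auto simp: SOL_iff_VI admissible_def)
  moreover have "norm (w\<^sub>1 - w\<^sub>2) \<le> norm (w\<^sub>1 - v) + norm (v - w\<^sub>2)"
    using norm_triangle_ineq[of "w\<^sub>1 - v" "v - w\<^sub>2"] by simp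
  ultimately have "(1 - k * (1 + L / \<eta>)) * norm (w\<^sub>1 - w\<^sub>2) \<le> norm (F\<^sub>1 w\<^sub>2 - F\<^sub>2 w\<^sub>2) / \<eta>"
    by (simp add: left_diff_distrib)
  then have "norm (w\<^sub>1 - w\<^sub>2) \<le> norm (F\<^sub>1 w\<^sub>2 - F\<^sub>2 w\<^sub>2) / \<eta> / (1 - k * (1 + L / \<eta>))"
    using constants(4) by (subst pos_le_divide_eq) (auto simp: mult.commute)
  then show ?thesis
    by simp
qed

lemma SOL_unique_solution:
  assumes F: "admissible F"
  shows "\<exists>!w. w \<in> SOL \<Omega> K F"
proof (rule ex_ex1I)
  define S where "S u = (SOME w. w \<in> VI (K u) F)" for u
  have S: "S u \<in> VI (K u) F" if "u \<in> \<Omega>" for u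
    unfolding S_def using VI_exists[OF F that] by (metis someI)
  have "\<exists>!w\<in>\<Omega>. S w = w"
  proof (rule Banach_fix)
    show "complete \<Omega>"
      using \<Omega>(1) complete_eq_closed by blast
    show "S ` \<Omega> \<subseteq> \<Omega>"
      using S K(1) by (auto simp: VI_def)
    show "dist (S u) (S v) \<le> k * (1 + L / \<eta>) * dist u v" if "u \<in> \<Omega>" "v \<in> \<Omega>" for u v
      unfolding dist_norm using VI_stability_in_constraint[OF F that S[OF that(1)] S[OF that(2)]] .
  qed (use \<Omega> constants in auto)
  then show "\<exists>w. w \<in> SOL \<Omega> K F"
    using S by (metis SOL_iff_VI)
  show "w = w'" if "w \<in> SOL \<Omega> K F" "w' \<in> SOL \<Omega> K F" for w w'
    using SOL_stability[OF F that] by simp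
qed

end

section \<open>Bochner integrals tested against vectors\<close>

text \<open>
  Without separability the difference of two measurable functions need not be measurable. If one of
  them is simple, one can argue separately on each of its finitely many level sets.
\<close>

lemma borel_measurable_norm_diff_simple:
  fixes h \<sigma> :: "'s \<Rightarrow> 'a::real_normed_vector"
  assumes h: "h \<in> borel_measurable M" and \<sigma>: "simple_function M \<sigma>"
  shows "(\<lambda>z. norm (h z - \<sigma> z)) \<in> borel_measurable M"
proof -
  have fin: "finite (\<sigma> ` space M)"
    using \<sigma> by (simp add: simple_function_def)
  have S: "{z \<in> space M. \<sigma> z = y} \<in> sets M" for y
    using simple_functionD(2)[OF \<sigma>, of "{y}"] by (simp add: vimage_def Int_def conj_commute)
  have c: "(\<lambda>z. norm (h z - y)) \<in> borel_measurable M" for y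
    by (rule measurable_compose[OF h, of "\<lambda>x. norm (x - y)"])
      (intro borel_measurable_continuous_onI continuous_intros)
  have "(\<lambda>z. \<Sum>y\<in>\<sigma> ` space M. indicator {z \<in> space M. \<sigma> z = y} z * norm (h z - y)) \<in> borel_measurable M"
    using S c by (intro borel_measurable_sum borel_measurable_times borel_measurable_indicator)
  also have "?this \<longleftrightarrow> ?thesis"
  proof (rule measurable_cong)
    fix z assume z: "z \<in> space M"
    have "(\<Sum>y\<in>\<sigma> ` space M. indicator {z \<in> space M. \<sigma> z = y} z * norm (h z - y))
        = (\<Sum>y\<in>\<sigma> ` space M. if y = \<sigma> z then norm (h z - y) else 0)"
      using z by (intro sum.cong) (auto simp: indicator_def)
    also have "\<dots> = norm (h z - \<sigma> z)"
      using fin z by (simp add: sum.delta)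
    finally show "(\<Sum>y\<in>\<sigma> ` space M. indicator {z \<in> space M. \<sigma> z = y} z * norm (h z - y))
        = norm (h z - \<sigma> z)" .
  qed
  finally show ?thesis .
qed

text \<open>
  Dominated convergence is applied only to the real functions \<open>norm (h z - \<sigma> n z)\<close>; it makes the
  integrals of the simple functions \<open>\<sigma> n\<close> a Cauchy sequence.
\<close>

lemma bochner_integrable_dominated:
  fixes h :: "'s \<Rightarrow> 'a::{real_normed_vector,complete_space}"
  assumes simple: "\<And>n. simple_function M (\<sigma> n)"
    and lim: "\<And>z. z \<in> space M \<Longrightarrow> (\<lambda>n. \<sigma> n z) \<longlonglongrightarrow> h z"
    and le: "\<And>n z. z \<in> space M \<Longrightarrow> norm (\<sigma> n z) \<le> w z" and w: "integrable M w"
  shows "bochner_integrable M h"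
proof -
  have [measurable]: "w \<in> borel_measurable M"
    using w by (rule borel_measurable_integrable)
  have h: "h \<in> borel_measurable M"
    using borel_measurable_LIMSEQ_metric[OF borel_measurable_simple_function[OF simple] lim] .
  have [measurable]: "(\<lambda>z. norm (h z - \<sigma> n z)) \<in> borel_measurable M" for n
    by (rule borel_measurable_norm_diff_simple[OF h simple])
  have w_fin: "(\<integral>\<^sup>+z. ennreal (w z) \<partial>M) < \<infinity>"
  proof -
    have "(\<integral>\<^sup>+z. ennreal (w z) \<partial>M) \<le> (\<integral>\<^sup>+z. ennreal (norm (w z)) \<partial>M)"
      by (intro nn_integral_mono ennreal_leI) simp
    also have "\<dots> < \<infinity>"
      using w by (simp add: integrable_iff_bounded)
    finally show ?thesis .
  qed
  have int: "Bochner_Integration.simple_bochner_integrable M (\<sigma> n)" for n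
  proof (rule simple_bochner_integrableI_bounded[OF simple])
    have "(\<integral>\<^sup>+z. norm (\<sigma> n z) \<partial>M) \<le> (\<integral>\<^sup>+z. ennreal (w z) \<partial>M)"
      by (intro nn_integral_mono ennreal_leI le)
    with w_fin show "(\<integral>\<^sup>+z. norm (\<sigma> n z) \<partial>M) < \<infinity>"
      by simp
  qed
  define a where "a n = (\<integral>\<^sup>+z. norm (h z - \<sigma> n z) \<partial>M)" for n
  have h_le: "norm (h z) \<le> w z" if "z \<in> space M" for z
    using le[OF that] by (intro LIMSEQ_le_const2[OF tendsto_norm[OF lim[OF that]]]) blast
  have a: "a \<longlonglongrightarrow> 0"
  proof -
    have "(\<lambda>n. \<integral>\<^sup>+z. norm (h z - \<sigma> n z) \<partial>M) \<longlonglongrightarrow> (\<integral>\<^sup>+z. 0 \<partial>M)"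
    proof (rule nn_integral_dominated_convergence[where w = "\<lambda>z. ennreal (2 * w z)"])
      show "AE z in M. ennreal (norm (h z - \<sigma> n z)) \<le> ennreal (2 * w z)" for n
      proof (intro AE_I2 ennreal_leI)
        fix z assume z: "z \<in> space M"
        show "norm (h z - \<sigma> n z) \<le> 2 * w z"
          using norm_triangle_ineq4[of "h z" "\<sigma> n z"] h_le[OF z] le[OF z, of n] by linarith
      qed
      have "(\<integral>\<^sup>+z. ennreal (2 * w z) \<partial>M) = ennreal 2 * (\<integral>\<^sup>+z. ennreal (w z) \<partial>M)"
        by (subst nn_integral_cmult[symmetric]) (auto simp: ennreal_mult' intro!: nn_integral_cong)
      then show "(\<integral>\<^sup>+z. ennreal (2 * w z) \<partial>M) < \<infinity>"
        using w_fin by (simp add: ennreal_mult_less_top)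
      show "AE z in M. (\<lambda>n. ennreal (norm (h z - \<sigma> n z))) \<longlonglongrightarrow> 0"
      proof (intro AE_I2)
        fix z assume z: "z \<in> space M"
        have "(\<lambda>n. norm (h z - \<sigma> n z)) \<longlonglongrightarrow> norm (h z - h z)"
          by (intro tendsto_intros lim z)
        then show "(\<lambda>n. ennreal (norm (h z - \<sigma> n z))) \<longlonglongrightarrow> 0"
          using tendsto_ennrealI by fastforce
      qed
    qed auto
    then show ?thesis
      unfolding a_def[abs_def] by simp
  qed
  have diff_le: "ennreal (norm (Bochner_Integration.simple_bochner_integral M (\<sigma> m) - Bochner_Integration.simple_bochner_integral M (\<sigma> n))) \<le> a m + a n"
    for m n
  proof -
    have int': "Bochner_Integration.simple_bochner_integrable M (\<lambda>z. \<sigma> m z - \<sigma> n z)"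
      by (rule simple_bochner_integrable_compose2) (auto simp: int)
    have int'': "Bochner_Integration.simple_bochner_integrable M (\<lambda>z. norm (\<sigma> m z - \<sigma> n z))"
      by (rule simple_bochner_integrable_compose2[where p = "\<lambda>x y. norm (x - y)"]) (auto simp: int)
    have "ennreal (norm (Bochner_Integration.simple_bochner_integral M (\<sigma> m) - Bochner_Integration.simple_bochner_integral M (\<sigma> n)))
        = ennreal (norm (Bochner_Integration.simple_bochner_integral M (\<lambda>z. \<sigma> m z - \<sigma> n z)))"
      by (simp add: simple_bochner_integral_diff int)
    also have "\<dots> \<le> ennreal (Bochner_Integration.simple_bochner_integral M (\<lambda>z. norm (\<sigma> m z - \<sigma> n z)))"
      by (intro ennreal_leI simple_bochner_integral_norm_bound int')
    also have "\<dots> = (\<integral>\<^sup>+z. norm (\<sigma> m z - \<sigma> n z) \<partial>M)"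
      by (rule simple_bochner_integral_eq_nn_integral[OF int'']) simp
    also have "\<dots> \<le> (\<integral>\<^sup>+z. ennreal (norm (h z - \<sigma> m z)) + ennreal (norm (h z - \<sigma> n z)) \<partial>M)"
    proof (rule nn_integral_mono)
      fix z
      have "norm (\<sigma> m z - \<sigma> n z) \<le> norm (h z - \<sigma> m z) + norm (h z - \<sigma> n z)"
        using norm_triangle_ineq4[of "h z - \<sigma> n z" "h z - \<sigma> m z"] by simp
      then show "ennreal (norm (\<sigma> m z - \<sigma> n z)) \<le> ennreal (norm (h z - \<sigma> m z)) + ennreal (norm (h z - \<sigma> n z))"
        by (simp flip: ennreal_plus)
    qed
    also have "\<dots> = a m + a n"
      unfolding a_def by (rule nn_integral_add) auto
    finally show ?thesis .
  qed
  have "Cauchy (\<lambda>n. Bochner_Integration.simple_bochner_integral M (\<sigma> n))"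
  proof (rule metric_CauchyI)
    fix e :: real assume "e > 0"
    then have "\<forall>\<^sub>F n in sequentially. a n < ennreal (e / 2)"
      using a by (intro order_tendstoD) auto
    then obtain N where N: "\<And>n. n \<ge> N \<Longrightarrow> a n < ennreal (e / 2)"
      unfolding eventually_sequentially by blast
    have "dist (Bochner_Integration.simple_bochner_integral M (\<sigma> m)) (Bochner_Integration.simple_bochner_integral M (\<sigma> n)) < e"
      if "m \<ge> N" "n \<ge> N" for m n
    proof -
      have "a m + a n < ennreal (e / 2) + ennreal (e / 2)"
        by (intro add_strict_mono N that)
      also have "\<dots> = ennreal e"
        using \<open>e > 0\<close> by (simp flip: ennreal_plus)
      finally have "ennreal (norm (Bochner_Integration.simple_bochner_integral M (\<sigma> m) - Bochner_Integration.simple_bochner_integral M (\<sigma> n))) < ennreal e"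
        using diff_le[of m n] by (rule le_less_trans[rotated])
      then show ?thesis
        by (simp add: dist_norm ennreal_less_iff)
    qed
    then show "\<exists>N. \<forall>m\<ge>N. \<forall>n\<ge>N.
        dist (Bochner_Integration.simple_bochner_integral M (\<sigma> m)) (Bochner_Integration.simple_bochner_integral M (\<sigma> n)) < e"
      by blast
  qed
  then obtain J where "(\<lambda>n. Bochner_Integration.simple_bochner_integral M (\<sigma> n)) \<longlonglongrightarrow> J"
    using Cauchy_convergent_iff convergent_def by blast
  then show ?thesis
    using h int a unfolding bochner_integrable_def has_bochner_int_def a_def by blast
qed

lemma has_bochner_int_inner:
  fixes h :: "'s \<Rightarrow> 'a::real_inner"
  assumes "has_bochner_int M h J"
  shows "has_bochner_integral M (\<lambda>z. inner (h z) v) (inner J v)"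
proof -
  obtain \<sigma> where h: "h \<in> borel_measurable M" and \<sigma>: "\<And>n::nat. Bochner_Integration.simple_bochner_integrable M (\<sigma> n)"
    and L1: "(\<lambda>n. \<integral>\<^sup>+ z. ennreal (norm (h z - \<sigma> n z)) \<partial>M) \<longlonglongrightarrow> 0"
    and J: "(\<lambda>n. Bochner_Integration.simple_bochner_integral M (\<sigma> n)) \<longlonglongrightarrow> J"
    using assms unfolding has_bochner_int_def by blast
  have simple: "simple_function M (\<sigma> n)" for n
    using \<sigma>[of n] by (auto elim: simple_bochner_integrable.cases)
  have meas: "(\<lambda>z. norm (h z - \<sigma> n z)) \<in> borel_measurable M" for n
    by (rule borel_measurable_norm_diff_simple[OF h simple])
  show ?thesis
  proof (rule has_bochner_integral.intros[where s = "\<lambda>n z. inner (\<sigma> n z) v"])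
    show "(\<lambda>z. inner (h z) v) \<in> borel_measurable M"
      by (rule measurable_compose[OF h, of "\<lambda>x. inner x v"])
        (intro borel_measurable_continuous_onI continuous_intros)
    show "Bochner_Integration.simple_bochner_integrable M (\<lambda>z. inner (\<sigma> n z) v)" for n
      by (rule simple_bochner_integrable_compose2[where p = "\<lambda>x y. inner x v", OF _ \<sigma> \<sigma>]) simp
    have "(\<lambda>n. inner (Bochner_Integration.simple_bochner_integral M (\<sigma> n)) v) \<longlonglongrightarrow> inner J v"
      by (intro tendsto_intros J)
    then show "(\<lambda>n. Bochner_Integration.simple_bochner_integral M (\<lambda>z. inner (\<sigma> n z) v)) \<longlonglongrightarrow> inner J v"
      using simple_bochner_integral_linear[OF bounded_linear.linear[OF bounded_linear_inner_left] \<sigma>]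
      by simp
    show "(\<lambda>n. \<integral>\<^sup>+ z. ennreal (norm (inner (h z) v - inner (\<sigma> n z) v)) \<partial>M) \<longlonglongrightarrow> 0"
    proof (rule tendsto_sandwich[OF _ _ tendsto_const])
      have "(\<lambda>n. ennreal (norm v) * (\<integral>\<^sup>+ z. ennreal (norm (h z - \<sigma> n z)) \<partial>M)) \<longlonglongrightarrow> ennreal (norm v) * 0"
        by (intro ennreal_tendsto_cmult L1) simp
      then show "(\<lambda>n. ennreal (norm v) * (\<integral>\<^sup>+ z. ennreal (norm (h z - \<sigma> n z)) \<partial>M)) \<longlonglongrightarrow> 0"
        by simp
      show "\<forall>\<^sub>F n in sequentially. (\<integral>\<^sup>+ z. ennreal (norm (inner (h z) v - inner (\<sigma> n z) v)) \<partial>M)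
          \<le> ennreal (norm v) * (\<integral>\<^sup>+ z. ennreal (norm (h z - \<sigma> n z)) \<partial>M)"
      proof (intro always_eventually allI)
        fix n
        have "ennreal (norm (inner (h z) v - inner (\<sigma> n z) v)) \<le> ennreal (norm v) * ennreal (norm (h z - \<sigma> n z))" for z
          using Cauchy_Schwarz_ineq2[of "h z - \<sigma> n z" v]
          by (simp add: inner_diff ennreal_leI mult.commute flip: ennreal_mult)
        then have "(\<integral>\<^sup>+ z. ennreal (norm (inner (h z) v - inner (\<sigma> n z) v)) \<partial>M)
            \<le> (\<integral>\<^sup>+ z. ennreal (norm v) * ennreal (norm (h z - \<sigma> n z)) \<partial>M)"
          by (intro nn_integral_mono)
        also have "\<dots> = ennreal (norm v) * (\<integral>\<^sup>+ z. ennreal (norm (h z - \<sigma> n z)) \<partial>M)"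
          by (rule nn_integral_cmult) (use meas in measurable)
        finally show "(\<integral>\<^sup>+ z. ennreal (norm (inner (h z) v - inner (\<sigma> n z) v)) \<partial>M)
            \<le> ennreal (norm v) * (\<integral>\<^sup>+ z. ennreal (norm (h z - \<sigma> n z)) \<partial>M)" .
      qed
    qed simp
  qed
qed

text \<open>
  The weak form determines the integral: vectors with equal inner products against every \<open>v\<close> agree.
\<close>

lemma bochner_int_inner:
  fixes h :: "'s \<Rightarrow> 'a::real_inner"
  assumes "bochner_integrable M h"
  shows "has_bochner_integral M (\<lambda>z. inner (h z) v) (inner (bochner_int M h) v)"
proof -
  obtain J where J: "has_bochner_int M h J"
    using assms unfolding bochner_integrable_def by blast
  have "bochner_int M h = J"
    unfolding bochner_int_def
  proof (rule the_equality[of "has_bochner_int M h", OF J])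
    fix J' assume "has_bochner_int M h J'"
    then have "inner J' v = inner J v" for v
      using has_bochner_int_inner[OF J] has_bochner_int_inner has_bochner_integral_eq by blast
    then show "J' = J"
      by (metis inner_eq_zero_iff inner_diff_left right_minus_eq)
  qed
  then show ?thesis
    using has_bochner_int_inner[OF J] by simp
qed

text \<open>
  The approximating functions multiply simple approximations of the kernel \<open>k\<close> by the values of \<open>c\<close> on
  a grid. They take finitely many values, so they are measurable whatever the size of the target space.
\<close>

lemma bochner_integrable_scaleR_continuous:
  fixes c :: "real \<Rightarrow> 'a::{real_normed_vector,complete_space}"
  assumes k: "integrable (lebesgue_on {0..s}) k" and c: "continuous_on {0..s} c"
  shows "bochner_integrable (lebesgue_on {0..s}) (\<lambda>\<zeta>. k \<zeta> *\<^sub>R c \<zeta>)"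
proof -
  let ?M = "lebesgue_on {0..s}"
  have k_meas: "k \<in> borel_measurable ?M"
    using k by (rule borel_measurable_integrable)
  obtain \<kappa> where \<kappa>: "\<And>n. simple_function ?M (\<kappa> n)"
    "\<And>\<zeta>. \<zeta> \<in> {0..s} \<Longrightarrow> (\<lambda>n. \<kappa> n \<zeta>) \<longlonglongrightarrow> k \<zeta>"
    "\<And>n \<zeta>. \<zeta> \<in> {0..s} \<Longrightarrow> dist (\<kappa> n \<zeta>) 0 \<le> 2 * dist (k \<zeta>) 0"
    using borel_measurable_implies_sequence_metric[OF k_meas, of 0] unfolding space_lebesgue_on by metis
  define \<tau> where "\<tau> n \<zeta> = real_of_int \<lfloor>real (Suc n) * \<zeta>\<rfloor> / real (Suc n)" for n \<zeta>
  have \<tau>_le: "\<zeta> - inverse (real (Suc n)) \<le> \<tau> n \<zeta>" "\<tau> n \<zeta> \<le> \<zeta>" for n \<zeta>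
  proof -
    have "real (Suc n) * \<zeta> - 1 \<le> real_of_int \<lfloor>real (Suc n) * \<zeta>\<rfloor>"
      by linarith
    then have "(real (Suc n) * \<zeta> - 1) / real (Suc n) \<le> \<tau> n \<zeta>"
      unfolding \<tau>_def by (rule divide_right_mono) simp
    then show "\<zeta> - inverse (real (Suc n)) \<le> \<tau> n \<zeta>"
      by (simp add: diff_divide_distrib inverse_eq_divide)
    have "real_of_int \<lfloor>real (Suc n) * \<zeta>\<rfloor> / real (Suc n) \<le> real (Suc n) * \<zeta> / real (Suc n)"
      by (rule divide_right_mono) auto
    then show "\<tau> n \<zeta> \<le> \<zeta>"
      unfolding \<tau>_def by simp
  qed
  have \<tau>_in: "\<tau> n \<zeta> \<in> {0..s}" if "\<zeta> \<in> {0..s}" for n \<zeta>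
    using that \<tau>_le(2)[of n \<zeta>] by (auto simp: \<tau>_def intro!: divide_nonneg_pos)
  have \<tau>_lim: "(\<lambda>n. \<tau> n \<zeta>) \<longlonglongrightarrow> \<zeta>" for \<zeta>
  proof (rule tendsto_sandwich[OF _ _ _ tendsto_const])
    show "(\<lambda>n. \<zeta> - inverse (real (Suc n))) \<longlonglongrightarrow> \<zeta>"
      using tendsto_diff[OF tendsto_const LIMSEQ_inverse_real_of_nat] by simp
  qed (use \<tau>_le in auto)
  have \<tau>_simple: "simple_function ?M (\<tau> n)" for n
  proof (rule simple_function_borel_measurable)
    have "\<tau> n \<in> borel_measurable borel"
      unfolding \<tau>_def by measurable
    then show "\<tau> n \<in> borel_measurable ?M"
      by (intro measurable_restrict_space1 measurable_completion) simp
    have "\<tau> n ` space ?M \<subseteq> (\<lambda>i. real_of_int i / real (Suc n)) ` {0..\<lfloor>real (Suc n) * s\<rfloor>}"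
    proof
      fix t assume "t \<in> \<tau> n ` space ?M"
      then obtain \<zeta> where \<zeta>: "0 \<le> \<zeta>" "\<zeta> \<le> s" "t = \<tau> n \<zeta>"
        by auto
      have "\<lfloor>real (Suc n) * \<zeta>\<rfloor> \<in> {0..\<lfloor>real (Suc n) * s\<rfloor>}"
        using \<zeta> by (auto intro!: floor_mono mult_left_mono)
      then show "t \<in> (\<lambda>i. real_of_int i / real (Suc n)) ` {0..\<lfloor>real (Suc n) * s\<rfloor>}"
        unfolding \<zeta>(3) \<tau>_def by blast
    qed
    then show "finite (\<tau> n ` space ?M)"
      using finite_surj by blast
  qed
  obtain B where B: "\<And>\<zeta>. \<zeta> \<in> {0..s} \<Longrightarrow> norm (c \<zeta>) \<le> B"
    using compact_imp_bounded[OF compact_continuous_image[OF c compact_Icc]]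
    unfolding bounded_iff by blast
  show ?thesis
  proof (rule bochner_integrable_dominated[where w = "\<lambda>\<zeta>. 2 * \<bar>k \<zeta>\<bar> * B"])
    show "simple_function ?M (\<lambda>\<zeta>. \<kappa> n \<zeta> *\<^sub>R c (\<tau> n \<zeta>))" for n
      by (rule simple_function_compose2[OF \<kappa>(1) \<tau>_simple])
    show "integrable ?M (\<lambda>\<zeta>. 2 * \<bar>k \<zeta>\<bar> * B)"
      using k by (intro integrable_mult_left integrable_mult_right integrable_abs)
    fix \<zeta> assume "\<zeta> \<in> space ?M"
    then have \<zeta>: "\<zeta> \<in> {0..s}"
      by simp
    have "(\<lambda>n. c (\<tau> n \<zeta>)) \<longlonglongrightarrow> c \<zeta>"
      using \<tau>_in[OF \<zeta>] by (intro continuous_on_tendsto_compose[OF c \<tau>_lim \<zeta>]) auto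
    then show "(\<lambda>n. \<kappa> n \<zeta> *\<^sub>R c (\<tau> n \<zeta>)) \<longlonglongrightarrow> k \<zeta> *\<^sub>R c \<zeta>"
      by (intro tendsto_intros \<kappa>(2) \<zeta>)
    show "norm (\<kappa> n \<zeta> *\<^sub>R c (\<tau> n \<zeta>)) \<le> 2 * \<bar>k \<zeta>\<bar> * B" for n
      using \<kappa>(3)[OF \<zeta>, of n] B[OF \<tau>_in[OF \<zeta>, of n]] by (auto intro!: mult_mono)
  qed
qed

section \<open>The weakly singular Abel kernel\<close>

lemma has_integral_abel_kernel:
  fixes q a b s :: real
  assumes "0 < q" "a \<le> b" "b \<le> s"
  shows "((\<lambda>\<zeta>. (s - \<zeta>) powr (q - 1)) has_integral ((s - a) powr q - (s - b) powr q) / q) {a..b}"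
proof -
  have "((\<lambda>\<zeta>. (s - \<zeta>) powr (q - 1)) has_integral (- ((s - b) powr q / q) - (- ((s - a) powr q / q)))) {a..b}"
  proof (rule fundamental_theorem_of_calculus_interior[OF \<open>a \<le> b\<close>])
    show "continuous_on {a..b} (\<lambda>\<zeta>. - ((s - \<zeta>) powr q / q))"
      using assms by (intro continuous_intros continuous_on_powr') auto
    show "((\<lambda>\<zeta>. - ((s - \<zeta>) powr q / q)) has_vector_derivative (s - x) powr (q - 1)) (at x)"
      if "x \<in> {a<..<b}" for x
      using that assms unfolding has_real_derivative_iff_has_vector_derivative[symmetric]
      by (auto intro!: derivative_eq_intros)
  qed
  then show ?thesis
    by (simp add: diff_divide_distrib)
qed

lemma integrable_abel_kernel_mult:
  fixes q a b s :: real
  assumes "0 < q" "a \<le> b" "b \<le> s" and \<phi>: "continuous_on {a..b} \<phi>"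
  shows "(\<lambda>\<zeta>. (s - \<zeta>) powr (q - 1) * \<phi> \<zeta>) integrable_on {a..b}"
proof -
  have "(\<lambda>\<zeta>. (s - \<zeta>) powr (q - 1)) absolutely_integrable_on {a..b}"
    using has_integral_abel_kernel[OF assms(1-3)] by (intro nonnegative_absolutely_integrable_1) auto
  moreover have "\<phi> \<in> borel_measurable (lebesgue_on {a..b})"
    by (rule continuous_imp_measurable_on_sets_lebesgue[OF \<phi>]) simp
  moreover have "bounded (\<phi> ` {a..b})"
    by (rule compact_imp_bounded[OF compact_continuous_image[OF \<phi> compact_Icc]])
  ultimately have "(\<lambda>\<zeta>. \<phi> \<zeta> * (s - \<zeta>) powr (q - 1)) absolutely_integrable_on {a..b}"
    by (intro absolutely_integrable_bounded_measurable_product_real) auto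
  then show ?thesis
    using set_lebesgue_integral_eq_integral(1) by (force simp: mult.commute)
qed

text \<open>
  The substitution \<open>t = \<gamma> * (s - \<zeta>)\<close> turns the integral into an initial piece of Euler's integral
  for \<open>Gamma q\<close>.
\<close>

lemma integral_abel_kernel_exp_le:
  fixes q \<gamma> s :: real
  assumes "0 < q" "0 < \<gamma>" "0 \<le> s"
  shows "integral {0..s} (\<lambda>\<zeta>. (s - \<zeta>) powr (q - 1) * exp (\<gamma> * \<zeta>)) \<le> exp (\<gamma> * s) * (Gamma q / \<gamma> powr q)"
proof -
  define F where "F t = t powr (q - 1) / exp t" for t :: real
  have G: "(F has_integral Gamma q) {0..}"
    unfolding F_def using Gamma_integral_real[OF \<open>0 < q\<close>] .
  have FI: "F integrable_on {0..\<gamma> * s}"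
    using integrable_on_subinterval[of F "{0..}" 0 "\<gamma> * s"] G by (auto simp: has_integral_integrable)
  define i where "i = integral {0..\<gamma> * s} F"
  have "i \<le> integral {0..} F"
    unfolding i_def using FI G by (intro integral_subset_le) (auto simp: F_def)
  then have "i \<le> Gamma q"
    using G by (simp add: integral_unique)
  have "(F has_integral i) (cbox 0 (\<gamma> * s))"
    using FI by (simp add: i_def integrable_integral)
  from has_integral_affinity[OF this, of "- \<gamma>" "\<gamma> * s"]
  have "((\<lambda>x. F (\<gamma> * s - \<gamma> * x)) has_integral (1 / \<gamma>) * i) ((\<lambda>x. s - x / \<gamma>) ` {0..\<gamma> * s})"
    using \<open>0 < \<gamma>\<close> by (simp add: algebra_simps)
  also have "(\<lambda>x. s - x / \<gamma>) ` {0..\<gamma> * s} = {0..s}"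
  proof (rule set_eqI, rule iffI)
    fix x assume "x \<in> {0..s}"
    then show "x \<in> (\<lambda>x. s - x / \<gamma>) ` {0..\<gamma> * s}"
      using \<open>0 < \<gamma>\<close> by (intro image_eqI[of _ _ "\<gamma> * (s - x)"]) auto
  qed (use \<open>0 < \<gamma>\<close> in \<open>auto simp: field_simps\<close>)
  finally have I: "((\<lambda>x. F (\<gamma> * s - \<gamma> * x)) has_integral i / \<gamma>) {0..s}"
    by simp
  have "((\<lambda>x. (exp (\<gamma> * s) * \<gamma> powr (1 - q)) * F (\<gamma> * s - \<gamma> * x)) has_integral
      (exp (\<gamma> * s) * \<gamma> powr (1 - q)) * (i / \<gamma>)) {0..s}"
    by (rule has_integral_mult_right[OF I])
  also have "?this \<longleftrightarrow> ((\<lambda>\<zeta>. (s - \<zeta>) powr (q - 1) * exp (\<gamma> * \<zeta>)) has_integral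
      (exp (\<gamma> * s) * \<gamma> powr (1 - q)) * (i / \<gamma>)) {0..s}"
  proof (rule has_integral_cong)
    fix x assume x: "x \<in> {0..s}"
    have "F (\<gamma> * s - \<gamma> * x) = \<gamma> powr (q - 1) * (s - x) powr (q - 1) / (exp (\<gamma> * s) / exp (\<gamma> * x))"
      unfolding F_def exp_diff[symmetric] right_diff_distrib[symmetric]
      using x \<open>0 < \<gamma>\<close> by (simp add: powr_mult)
    then have "exp (\<gamma> * s) * \<gamma> powr (1 - q) * F (\<gamma> * s - \<gamma> * x)
        = (\<gamma> powr (1 - q) * \<gamma> powr (q - 1)) * ((s - x) powr (q - 1) * exp (\<gamma> * x))"
      by (simp add: field_simps)
    also have "\<gamma> powr (1 - q) * \<gamma> powr (q - 1) = 1"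
      using \<open>0 < \<gamma>\<close> by (simp flip: powr_add)
    finally show "exp (\<gamma> * s) * \<gamma> powr (1 - q) * F (\<gamma> * s - \<gamma> * x) = (s - x) powr (q - 1) * exp (\<gamma> * x)"
      by simp
  qed
  finally have "integral {0..s} (\<lambda>\<zeta>. (s - \<zeta>) powr (q - 1) * exp (\<gamma> * \<zeta>))
      = exp (\<gamma> * s) * (\<gamma> powr (1 - q) / \<gamma> * i)"
    by (simp add: integral_unique)
  also have "\<gamma> powr (1 - q) / \<gamma> = 1 / \<gamma> powr q"
    using \<open>0 < \<gamma>\<close> by (simp add: powr_diff)
  also have "exp (\<gamma> * s) * (1 / \<gamma> powr q * i) \<le> exp (\<gamma> * s) * (Gamma q / \<gamma> powr q)"
    using \<open>i \<le> Gamma q\<close> by (simp add: divide_right_mono)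
  finally show ?thesis .
qed

text \<open>
  The Riemann--Liouville integral of order \<open>q\<close>, without its factor \<open>1 / Gamma q\<close>.
\<close>

definition abel_integral :: "real \<Rightarrow> (real \<Rightarrow> 'a::real_normed_vector) \<Rightarrow> real \<Rightarrow> 'a" where
  "abel_integral q c s = bochner_int (lebesgue_on {0..s}) (\<lambda>\<zeta>. (s - \<zeta>) powr (q - 1) *\<^sub>R c \<zeta>)"

lemma bochner_integrable_abel:
  fixes c :: "real \<Rightarrow> 'a::{real_normed_vector,complete_space}"
  assumes "0 < q" "0 \<le> s" "continuous_on {0..s} c"
  shows "bochner_integrable (lebesgue_on {0..s}) (\<lambda>\<zeta>. (s - \<zeta>) powr (q - 1) *\<^sub>R c \<zeta>)"
proof (rule bochner_integrable_scaleR_continuous[OF _ assms(3)])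
  have "(\<lambda>\<zeta>. (s - \<zeta>) powr (q - 1)) absolutely_integrable_on {0..s}"
    using has_integral_abel_kernel[OF assms(1,2) order_refl]
    by (intro nonnegative_absolutely_integrable_1) auto
  then show "integrable (lebesgue_on {0..s}) (\<lambda>\<zeta>. (s - \<zeta>) powr (q - 1))"
    by (rule absolutely_integrable_imp_integrable) simp
qed

lemma inner_abel_integral:
  fixes c :: "real \<Rightarrow> 'a::{real_inner,complete_space}"
  assumes "0 < q" "0 \<le> s" "continuous_on {0..s} c"
  shows "inner (abel_integral q c s) v = integral {0..s} (\<lambda>\<zeta>. (s - \<zeta>) powr (q - 1) * inner (c \<zeta>) v)"
proof -
  have I: "has_bochner_integral (lebesgue_on {0..s}) (\<lambda>\<zeta>. (s - \<zeta>) powr (q - 1) * inner (c \<zeta>) v)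
      (inner (abel_integral q c s) v)"
    using bochner_int_inner[OF bochner_integrable_abel[OF assms], of v] by (simp add: abel_integral_def)
  then show ?thesis
    using lebesgue_integral_eq_integral[OF integrable.intros[OF I]] has_bochner_integral_integral_eq[OF I]
    by simp
qed

lemma norm_le_if_inner_le:
  fixes J :: "'a::real_inner"
  assumes "inner J J \<le> B * norm J" "0 \<le> B"
  shows "norm J \<le> B"
  using assms by (cases "J = 0") (auto simp: power2_norm_eq_inner[symmetric] power2_eq_square)

text \<open>
  The inner product with the difference of the two integrals turns the claim into a comparison of real
  integrals.
\<close>

lemma abel_integral_diff_le:
  fixes c d :: "real \<Rightarrow> 'a::{real_inner,complete_space}"
  assumes q: "0 < q" and s: "0 \<le> s" and c: "continuous_on {0..s} c" and d: "continuous_on {0..s} d"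
    and b: "continuous_on {0..s} b" and le: "\<And>\<zeta>. \<zeta> \<in> {0..s} \<Longrightarrow> norm (c \<zeta> - d \<zeta>) \<le> b \<zeta>"
  shows "norm (abel_integral q c s - abel_integral q d s) \<le> integral {0..s} (\<lambda>\<zeta>. (s - \<zeta>) powr (q - 1) * b \<zeta>)"
proof (rule norm_le_if_inner_le)
  define v where "v = abel_integral q c s - abel_integral q d s"
  have b0: "0 \<le> b \<zeta>" if "\<zeta> \<in> {0..s}" for \<zeta>
    using order_trans[OF norm_ge_zero le[OF that]] .
  have I: "(\<lambda>\<zeta>. (s - \<zeta>) powr (q - 1) * \<phi> \<zeta>) integrable_on {0..s}" if "continuous_on {0..s} \<phi>" for \<phi>
    by (rule integrable_abel_kernel_mult[OF q s order_refl that])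
  show "0 \<le> integral {0..s} (\<lambda>\<zeta>. (s - \<zeta>) powr (q - 1) * b \<zeta>)"
    using b0 by (intro integral_nonneg I b) auto
  have "inner v v = integral {0..s} (\<lambda>\<zeta>. (s - \<zeta>) powr (q - 1) * inner (c \<zeta>) v)
      - integral {0..s} (\<lambda>\<zeta>. (s - \<zeta>) powr (q - 1) * inner (d \<zeta>) v)"
    using inner_abel_integral[OF q s c] inner_abel_integral[OF q s d] by (simp add: v_def inner_diff_left)
  also have "\<dots> = integral {0..s} (\<lambda>\<zeta>. (s - \<zeta>) powr (q - 1) * inner (c \<zeta>) v - (s - \<zeta>) powr (q - 1) * inner (d \<zeta>) v)"
    by (intro integral_diff[symmetric] I continuous_intros c d)
  also have "\<dots> \<le> integral {0..s} (\<lambda>\<zeta>. (s - \<zeta>) powr (q - 1) * (b \<zeta> * norm v))"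
  proof (intro integral_le integrable_diff I continuous_intros c d b)
    fix \<zeta> assume \<zeta>: "\<zeta> \<in> {0..s}"
    have "inner (c \<zeta> - d \<zeta>) v \<le> b \<zeta> * norm v"
      using norm_cauchy_schwarz[of "c \<zeta> - d \<zeta>" v] mult_right_mono[OF le[OF \<zeta>] norm_ge_zero[of v]] by linarith
    then show "(s - \<zeta>) powr (q - 1) * inner (c \<zeta>) v - (s - \<zeta>) powr (q - 1) * inner (d \<zeta>) v
        \<le> (s - \<zeta>) powr (q - 1) * (b \<zeta> * norm v)"
      by (simp add: inner_diff_left mult_left_mono flip: right_diff_distrib)
  qed
  also have "\<dots> = integral {0..s} (\<lambda>\<zeta>. (s - \<zeta>) powr (q - 1) * b \<zeta>) * norm v"
    by (simp add: mult.assoc[symmetric])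
  finally show "inner (abel_integral q c s - abel_integral q d s) (abel_integral q c s - abel_integral q d s)
      \<le> integral {0..s} (\<lambda>\<zeta>. (s - \<zeta>) powr (q - 1) * b \<zeta>) * norm (abel_integral q c s - abel_integral q d s)"
    by (simp add: v_def)
qed

lemma abel_integral_cong:
  fixes c d :: "real \<Rightarrow> 'a::{real_inner,complete_space}"
  assumes "0 < q" "0 \<le> s" "continuous_on {0..s} c" and eq: "\<And>\<zeta>. \<zeta> \<in> {0..s} \<Longrightarrow> c \<zeta> = d \<zeta>"
  shows "abel_integral q c s = abel_integral q d s"
proof -
  have "continuous_on {0..s} d"
    using continuous_on_cong[of "{0..s}" "{0..s}" c d] assms(3) eq by blast
  then have "norm (abel_integral q c s - abel_integral q d s) \<le> integral {0..s} (\<lambda>\<zeta>. (s - \<zeta>) powr (q - 1) * 0)"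
    using assms by (intro abel_integral_diff_le) auto
  then show ?thesis
    by simp
qed

text \<open>
  The kernel increases when its upper limit decreases, so on \<open>{0..s}\<close> the difference of the two kernels
  has one sign and its integral can be evaluated; together with the piece over \<open>{s..t}\<close> this gives a
  bound that depends on \<open>t - s\<close> alone.
\<close>

lemma abel_integral_Hoelder:
  fixes c :: "real \<Rightarrow> 'a::{real_inner,complete_space}"
  assumes q: "0 < q" "q \<le> 1" and s: "0 \<le> s" "s \<le> t" and c: "continuous_on {0..t} c"
    and B: "\<And>\<zeta>. \<zeta> \<in> {0..t} \<Longrightarrow> norm (c \<zeta>) \<le> B"
  shows "norm (abel_integral q c t - abel_integral q c s) \<le> B * (2 * (t - s) powr q / q)"
proof (rule norm_le_if_inner_le)
  have "0 \<le> B"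
    using order_trans[OF norm_ge_zero B[of 0]] s by simp
  then show "0 \<le> B * (2 * (t - s) powr q / q)"
    using q by auto
  define v where "v = abel_integral q c t - abel_integral q c s"
  define \<phi> where "\<phi> \<zeta> = inner (c \<zeta>) v" for \<zeta>
  have \<phi>: "continuous_on {0..t} \<phi>"
    unfolding \<phi>_def by (intro continuous_intros c)
  then have \<phi>': "continuous_on {0..s} \<phi>" "continuous_on {s..t} \<phi>"
    using s by (auto intro: continuous_on_subset)
  have \<phi>_le: "\<bar>\<phi> \<zeta>\<bar> \<le> B * norm v" if "\<zeta> \<in> {0..t}" for \<zeta>
    using Cauchy_Schwarz_ineq2[of "c \<zeta>" v] mult_right_mono[OF B[OF that] norm_ge_zero[of v]]
    unfolding \<phi>_def by linarith
  have ints: "(\<lambda>\<zeta>. (t - \<zeta>) powr (q - 1) * \<phi> \<zeta>) integrable_on {0..t}"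
      "(\<lambda>\<zeta>. (t - \<zeta>) powr (q - 1) * \<phi> \<zeta>) integrable_on {0..s}"
      "(\<lambda>\<zeta>. (t - \<zeta>) powr (q - 1) * \<phi> \<zeta>) integrable_on {s..t}"
      "(\<lambda>\<zeta>. (s - \<zeta>) powr (q - 1) * \<phi> \<zeta>) integrable_on {0..s}"
    using q s \<phi> \<phi>' by (auto intro!: integrable_abel_kernel_mult)
  note ks = has_integral_abel_kernel[OF q(1) s(1) order_refl]
  note kt = has_integral_abel_kernel[OF q(1) s]
  note kst = has_integral_abel_kernel[OF q(1) s(2) order_refl]
  have "inner v v = integral {0..t} (\<lambda>\<zeta>. (t - \<zeta>) powr (q - 1) * \<phi> \<zeta>)
      - integral {0..s} (\<lambda>\<zeta>. (s - \<zeta>) powr (q - 1) * \<phi> \<zeta>)"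
    unfolding \<phi>_def
    using inner_abel_integral[OF q(1) _ c, of v] s
      inner_abel_integral[OF q(1) s(1) continuous_on_subset[OF c], of v]
    by (simp add: v_def inner_diff_left)
  also have "\<dots> = integral {s..t} (\<lambda>\<zeta>. (t - \<zeta>) powr (q - 1) * \<phi> \<zeta>)
      - integral {0..s} (\<lambda>\<zeta>. (s - \<zeta>) powr (q - 1) * \<phi> \<zeta> - (t - \<zeta>) powr (q - 1) * \<phi> \<zeta>)"
    using Henstock_Kurzweil_Integration.integral_combine[OF s ints(1)] integral_diff[OF ints(4,2)] by simp
  also have "\<dots> \<le> B * norm v * ((t - s) powr q / q) + B * norm v * ((t - s) powr q / q)"
  proof -
    have "norm (integral {s..t} (\<lambda>\<zeta>. (t - \<zeta>) powr (q - 1) * \<phi> \<zeta>))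
        \<le> integral {s..t} (\<lambda>\<zeta>. B * norm v * (t - \<zeta>) powr (q - 1))"
    proof (intro Henstock_Kurzweil_Integration.integral_norm_bound_integral ints)
      show "(\<lambda>\<zeta>. B * norm v * (t - \<zeta>) powr (q - 1)) integrable_on {s..t}"
        by (rule has_integral_integrable[OF has_integral_mult_right[OF kst]])
      fix \<zeta> assume "\<zeta> \<in> {s..t}"
      then show "norm ((t - \<zeta>) powr (q - 1) * \<phi> \<zeta>) \<le> B * norm v * (t - \<zeta>) powr (q - 1)"
        using \<phi>_le[of \<zeta>] s by (auto simp: abs_mult mult.commute intro!: mult_right_mono)
    qed
    also have "\<dots> = B * norm v * ((t - s) powr q / q)"
      using integral_unique[OF kst] q by simp
    finally have 1: "norm (integral {s..t} (\<lambda>\<zeta>. (t - \<zeta>) powr (q - 1) * \<phi> \<zeta>)) \<le> B * norm v * ((t - s) powr q / q)" .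
    have kdiff: "((\<lambda>\<zeta>. B * norm v * ((s - \<zeta>) powr (q - 1) - (t - \<zeta>) powr (q - 1))) has_integral
        B * norm v * ((s powr q - 0) / q - (t powr q - (t - s) powr q) / q)) {0..s}"
      using has_integral_mult_right[OF has_integral_diff[OF ks kt], of "B * norm v"] by simp
    \<comment> \<open>At \<open>\<zeta> = s\<close> the kernel takes the value \<open>0 powr (q - 1) = 0\<close>, which breaks its monotonicity; the
      bound is changed at this single point.\<close>
    have "norm (integral {0..s} (\<lambda>\<zeta>. (s - \<zeta>) powr (q - 1) * \<phi> \<zeta> - (t - \<zeta>) powr (q - 1) * \<phi> \<zeta>))
        \<le> integral {0..s} (\<lambda>\<zeta>. if \<zeta> = s then \<bar>(t - s) powr (q - 1) * \<phi> s\<bar>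
            else B * norm v * ((s - \<zeta>) powr (q - 1) - (t - \<zeta>) powr (q - 1)))"
    proof (intro Henstock_Kurzweil_Integration.integral_norm_bound_integral integrable_diff ints)
      show "(\<lambda>\<zeta>. if \<zeta> = s then \<bar>(t - s) powr (q - 1) * \<phi> s\<bar>
          else B * norm v * ((s - \<zeta>) powr (q - 1) - (t - \<zeta>) powr (q - 1))) integrable_on {0..s}"
        by (rule integrable_spike[OF has_integral_integrable[OF kdiff], of "{s}"]) auto
      fix \<zeta> assume \<zeta>: "\<zeta> \<in> {0..s}"
      show "norm ((s - \<zeta>) powr (q - 1) * \<phi> \<zeta> - (t - \<zeta>) powr (q - 1) * \<phi> \<zeta>)
          \<le> (if \<zeta> = s then \<bar>(t - s) powr (q - 1) * \<phi> s\<bar>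
            else B * norm v * ((s - \<zeta>) powr (q - 1) - (t - \<zeta>) powr (q - 1)))"
      proof (cases "\<zeta> = s")
        case False
        then have "(t - \<zeta>) powr (q - 1) \<le> (s - \<zeta>) powr (q - 1)"
          using \<zeta> s q by (intro powr_mono2') auto
        then have "\<bar>(s - \<zeta>) powr (q - 1) - (t - \<zeta>) powr (q - 1)\<bar> * \<bar>\<phi> \<zeta>\<bar>
            \<le> ((s - \<zeta>) powr (q - 1) - (t - \<zeta>) powr (q - 1)) * (B * norm v)"
          using \<phi>_le[of \<zeta>] \<zeta> s by (intro mult_mono) auto
        then show ?thesis
          using False unfolding left_diff_distrib[symmetric] real_norm_def abs_mult
          by (simp add: mult.commute)
      qed auto
    qed
    also have "\<dots> = integral {0..s} (\<lambda>\<zeta>. B * norm v * ((s - \<zeta>) powr (q - 1) - (t - \<zeta>) powr (q - 1)))"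
      by (rule integral_spike[of "{s}"]) auto
    also have "\<dots> = B * norm v * ((s powr q - t powr q + (t - s) powr q) / q)"
      unfolding integral_unique[OF kdiff] by (simp add: diff_divide_distrib add_divide_distrib)
    also have "\<dots> \<le> B * norm v * ((t - s) powr q / q)"
    proof (intro mult_left_mono divide_right_mono)
      have "s powr q \<le> t powr q"
        using s q by (intro powr_mono2) auto
      then show "s powr q - t powr q + (t - s) powr q \<le> (t - s) powr q"
        by simp
    qed (use \<open>0 \<le> B\<close> q in auto)
    finally have 2: "norm (integral {0..s} (\<lambda>\<zeta>. (s - \<zeta>) powr (q - 1) * \<phi> \<zeta> - (t - \<zeta>) powr (q - 1) * \<phi> \<zeta>))
      \<le> B * norm v * ((t - s) powr q / q)" .
    show ?thesis
      using 1 2 unfolding real_norm_def by linarith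
  qed
  finally show "inner (abel_integral q c t - abel_integral q c s) (abel_integral q c t - abel_integral q c s)
      \<le> B * (2 * (t - s) powr q / q) * norm (abel_integral q c t - abel_integral q c s)"
    by (simp add: v_def algebra_simps)
qed

lemma continuous_on_abel_integral:
  fixes c :: "real \<Rightarrow> 'a::{real_inner,complete_space}"
  assumes q: "0 < q" "q \<le> 1" and c: "continuous_on {0..T} c"
  shows "continuous_on {0..T} (abel_integral q c)"
proof -
  obtain B where B: "\<And>\<zeta>. \<zeta> \<in> {0..T} \<Longrightarrow> norm (c \<zeta>) \<le> B"
    using compact_imp_bounded[OF compact_continuous_image[OF c compact_Icc]]
    unfolding bounded_iff by blast
  have le: "dist (abel_integral q c t) (abel_integral q c s) \<le> B * (2 * \<bar>t - s\<bar> powr q / q)"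
    if "s \<in> {0..T}" "t \<in> {0..T}" for s t
  proof -
    have *: "norm (abel_integral q c t - abel_integral q c s) \<le> B * (2 * (t - s) powr q / q)"
      if "0 \<le> s" "s \<le> t" "t \<le> T" for s t
      using that B by (intro abel_integral_Hoelder[OF q] continuous_on_subset[OF c]) auto
    show ?thesis
      using *[of s t] *[of t s] that
      by (cases "s \<le> t") (auto simp: dist_norm norm_minus_commute)
  qed
  show ?thesis
    unfolding continuous_on_def
  proof
    fix s assume s: "s \<in> {0..T}"
    have "((\<lambda>t. B * (2 * \<bar>t - s\<bar> powr q / q)) \<longlongrightarrow> B * (2 * \<bar>s - s\<bar> powr q / q)) (at s within {0..T})"
      using q by (intro tendsto_intros tendsto_powr') auto
    then have lim: "((\<lambda>t. B * (2 * \<bar>t - s\<bar> powr q / q)) \<longlongrightarrow> 0) (at s within {0..T})"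
      by simp
    show "(abel_integral q c \<longlongrightarrow> abel_integral q c s) (at s within {0..T})"
    proof (rule tendsto_dist_iff[THEN iffD2], rule tendsto_sandwich[OF _ _ tendsto_const lim])
      show "\<forall>\<^sub>F t in at s within {0..T}. dist (abel_integral q c t) (abel_integral q c s) \<le> B * (2 * \<bar>t - s\<bar> powr q / q)"
        using le[OF s] by (auto simp: eventually_at_filter)
    qed simp
  qed
qed

section \<open>The Bielecki norm\<close>

lemma bielecki_upper:
  assumes x: "continuous_on {0..T} x" and s: "s \<in> {0..T}"
  shows "exp (- (\<gamma> * s)) * norm (x s) \<le> bielecki_norm \<gamma> T x"
proof -
  have "continuous_on {0..T} (\<lambda>s. exp (- (\<gamma> * s)) * norm (x s))"
    by (intro continuous_intros x)
  then have "bdd_above ((\<lambda>s. exp (- (\<gamma> * s)) * norm (x s)) ` {0..T})"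
    by (intro bounded_imp_bdd_above compact_imp_bounded compact_continuous_image) auto
  then show ?thesis
    unfolding bielecki_norm_def using s by (rule cSUP_upper[rotated])
qed

lemma norm_le_bielecki:
  assumes "continuous_on {0..T} x" "s \<in> {0..T}"
  shows "norm (x s) \<le> bielecki_norm \<gamma> T x * exp (\<gamma> * s)"
  using bielecki_upper[OF assms, of \<gamma>] by (simp add: exp_minus field_simps)

lemma bielecki_least:
  assumes "0 \<le> T" "\<And>s. s \<in> {0..T} \<Longrightarrow> exp (- (\<gamma> * s)) * norm (x s) \<le> m"
  shows "bielecki_norm \<gamma> T x \<le> m"
  unfolding bielecki_norm_def using assms by (intro cSUP_least) auto

lemma bielecki_nonneg:
  assumes "0 \<le> T" "continuous_on {0..T} x"
  shows "0 \<le> bielecki_norm \<gamma> T x"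
proof -
  have "0 \<le> exp (- (\<gamma> * 0)) * norm (x 0)"
    by simp
  also have "\<dots> \<le> bielecki_norm \<gamma> T x"
    using assms by (intro bielecki_upper) auto
  finally show ?thesis .
qed

text \<open>
  The absolute value makes the distance nonnegative for arbitrary functions, including those with
  unbounded weighted norm; on continuous functions it changes nothing.
\<close>

definition bielecki_dist :: "real \<Rightarrow> real \<Rightarrow> (real \<Rightarrow> 'a::real_normed_vector) \<Rightarrow> (real \<Rightarrow> 'a) \<Rightarrow> real" where
  "bielecki_dist \<gamma> T x y = \<bar>bielecki_norm \<gamma> T (\<lambda>s. x s - y s)\<bar>"

lemma bielecki_dist_eq:
  assumes "0 \<le> T" "x \<in> cont_space T UNIV" "y \<in> cont_space T UNIV"
  shows "bielecki_dist \<gamma> T x y = bielecki_norm \<gamma> T (\<lambda>s. x s - y s)"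
  unfolding bielecki_dist_def using assms
  by (intro abs_of_nonneg bielecki_nonneg continuous_intros) (auto simp: cont_space_def)

lemma cont_space_eqI:
  assumes "x \<in> cont_space T Y" "y \<in> cont_space T Y'" "\<And>s. s \<in> {0..T} \<Longrightarrow> x s = y s"
  shows "x = y"
  using assms unfolding cont_space_def by (auto intro: extensionalityI[of _ "{0..T}"] simp: PiE_def)

lemma restrict_in_cont_space:
  assumes "continuous_on {0..T} l" "\<And>s. s \<in> {0..T} \<Longrightarrow> l s \<in> Y"
  shows "restrict l {0..T} \<in> cont_space T Y"
proof -
  have "continuous_on {0..T} (restrict l {0..T})"
    using assms(1) continuous_on_cong[of "{0..T}" "{0..T}" "restrict l {0..T}" l] by simp
  then show ?thesis
    using assms(2) by (auto simp: cont_space_def)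
qed

lemma Metric_space_bielecki:
  assumes T: "0 \<le> T"
  shows "Metric_space (cont_space T UNIV) (bielecki_dist \<gamma> T :: (real \<Rightarrow> 'a::real_normed_vector) \<Rightarrow> _)"
proof
  fix x y z :: "real \<Rightarrow> 'a"
  show "0 \<le> bielecki_dist \<gamma> T x y"
    by (simp add: bielecki_dist_def)
  show "bielecki_dist \<gamma> T x y = bielecki_dist \<gamma> T y x"
    by (simp add: bielecki_dist_def bielecki_norm_def norm_minus_commute)
  assume x: "x \<in> cont_space T UNIV" and y: "y \<in> cont_space T UNIV"
  have cont: "continuous_on {0..T} (\<lambda>s. u s - v s)" if "u \<in> cont_space T UNIV" "v \<in> cont_space T UNIV"
    for u v :: "real \<Rightarrow> 'a"
    using that by (intro continuous_intros) (auto simp: cont_space_def)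
  show "bielecki_dist \<gamma> T x y = 0 \<longleftrightarrow> x = y"
  proof
    assume "bielecki_dist \<gamma> T x y = 0"
    then have 0: "bielecki_norm \<gamma> T (\<lambda>s. x s - y s) = 0"
      by (simp add: bielecki_dist_def)
    show "x = y"
    proof (rule cont_space_eqI[OF x y])
      fix s assume "s \<in> {0..T}"
      from norm_le_bielecki[OF cont[OF x y] this, of \<gamma>] 0 show "x s = y s"
        by simp
    qed
  next
    assume "x = y"
    then show "bielecki_dist \<gamma> T x y = 0"
      using T by (simp add: bielecki_dist_def bielecki_norm_def)
  qed
  assume z: "z \<in> cont_space T UNIV"
  have "bielecki_norm \<gamma> T (\<lambda>s. x s - z s)
      \<le> bielecki_norm \<gamma> T (\<lambda>s. x s - y s) + bielecki_norm \<gamma> T (\<lambda>s. y s - z s)"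
  proof (rule bielecki_least[OF T])
    fix s assume s: "s \<in> {0..T}"
    have "exp (- (\<gamma> * s)) * norm (x s - z s) \<le> exp (- (\<gamma> * s)) * (norm (x s - y s) + norm (y s - z s))"
      using norm_triangle_ineq[of "x s - y s" "y s - z s"] by (intro mult_left_mono) auto
    also have "\<dots> \<le> bielecki_norm \<gamma> T (\<lambda>s. x s - y s) + bielecki_norm \<gamma> T (\<lambda>s. y s - z s)"
      unfolding distrib_left by (intro add_mono bielecki_upper[OF _ s] cont x y z)
    finally show "exp (- (\<gamma> * s)) * norm (x s - z s)
        \<le> bielecki_norm \<gamma> T (\<lambda>s. x s - y s) + bielecki_norm \<gamma> T (\<lambda>s. y s - z s)" .
  qed
  then show "bielecki_dist \<gamma> T x z \<le> bielecki_dist \<gamma> T x y + bielecki_dist \<gamma> T y z"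
    using T x y z by (simp add: bielecki_dist_eq)
qed

text \<open>
  On a compact interval the weight is bounded above and away from 0, so that Cauchy sequences for the
  Bielecki distance are exactly the uniformly Cauchy ones.
\<close>

lemma mcomplete_bielecki:
  assumes T: "0 \<le> T" and \<gamma>: "0 \<le> \<gamma>"
  shows "Metric_space.mcomplete (cont_space T UNIV)
    (bielecki_dist \<gamma> T :: (real \<Rightarrow> 'a::{real_normed_vector,complete_space}) \<Rightarrow> _)"
proof -
  interpret Metric_space "cont_space T UNIV" "bielecki_dist \<gamma> T :: (real \<Rightarrow> 'a) \<Rightarrow> _"
    by (rule Metric_space_bielecki[OF T])
  show ?thesis
    unfolding mcomplete_def
  proof (intro allI impI)
    fix X :: "nat \<Rightarrow> real \<Rightarrow> 'a" assume X: "MCauchy X"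
    then have X_in: "X n \<in> cont_space T UNIV" for n
      by (auto simp: MCauchy_def)
    then have X_cont: "continuous_on {0..T} (X n)" for n
      by (auto simp: cont_space_def)
    have "uniformly_Cauchy_on {0..T} X"
      unfolding uniformly_Cauchy_on_def
    proof (intro allI impI)
      fix e :: real assume "0 < e"
      then have "0 < e * exp (- (\<gamma> * T))"
        by simp
      then obtain N where N: "\<And>m n. N \<le> m \<Longrightarrow> N \<le> n \<Longrightarrow> bielecki_dist \<gamma> T (X m) (X n) < e * exp (- (\<gamma> * T))"
        using X unfolding MCauchy_def by metis
      have "dist (X m s) (X n s) < e" if s: "s \<in> {0..T}" and mn: "m \<ge> N" "n \<ge> N" for s m n
      proof -
        have "norm (X m s - X n s) \<le> bielecki_norm \<gamma> T (\<lambda>s. X m s - X n s) * exp (\<gamma> * s)"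
          by (intro norm_le_bielecki[OF _ s] continuous_intros X_cont)
        also have "\<dots> < e * exp (- (\<gamma> * T)) * exp (\<gamma> * s)"
          using N[OF mn] X_in T by (simp add: bielecki_dist_eq)
        also have "\<dots> \<le> e * exp (- (\<gamma> * T)) * exp (\<gamma> * T)"
          using s \<gamma> \<open>0 < e\<close> by (intro mult_left_mono) (auto intro: mult_left_mono)
        also have "\<dots> = e"
          by (simp add: exp_minus)
        finally show ?thesis
          by (simp add: dist_norm)
      qed
      then show "\<exists>N. \<forall>s\<in>{0..T}. \<forall>m\<ge>N. \<forall>n\<ge>N. dist (X m s) (X n s) < e"
        by blast
    qed
    then obtain l where l: "uniform_limit {0..T} X l sequentially"
      using Cauchy_uniformly_convergent uniformly_convergent_on_def by blast
    define x where "x = restrict l {0..T}"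
    have "continuous_on {0..T} l"
      by (rule uniform_limit_theorem[OF _ l]) (auto simp: X_cont)
    then have x: "x \<in> cont_space T UNIV"
      unfolding x_def by (rule restrict_in_cont_space) simp
    show "\<exists>x. limitin mtopology X x sequentially"
    proof (intro exI[of _ x], unfold limit_metric_sequentially, intro conjI allI impI x)
      fix e :: real assume "0 < e"
      then have "\<forall>\<^sub>F n in sequentially. \<forall>s\<in>{0..T}. dist (X n s) (l s) < e / 2"
        by (intro uniform_limitD[OF l]) simp
      then obtain N where N: "\<And>n s. N \<le> n \<Longrightarrow> s \<in> {0..T} \<Longrightarrow> dist (X n s) (l s) < e / 2"
        unfolding eventually_sequentially by blast
      have "bielecki_dist \<gamma> T (X n) x < e" if "N \<le> n" for n
      proof -
        have "bielecki_norm \<gamma> T (\<lambda>s. X n s - x s) \<le> e / 2"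
        proof (rule bielecki_least[OF T])
          fix s assume s: "s \<in> {0..T}"
          have "exp (- (\<gamma> * s)) * norm (X n s - x s) \<le> 1 * norm (X n s - x s)"
            using s \<gamma> by (intro mult_right_mono) auto
          also have "\<dots> \<le> e / 2"
            using N[OF that s] s by (simp add: x_def dist_norm)
          finally show "exp (- (\<gamma> * s)) * norm (X n s - x s) \<le> e / 2" .
        qed
        then show ?thesis
          using \<open>0 < e\<close> by (simp add: bielecki_dist_eq[OF T X_in x])
      qed
      then show "\<exists>N. \<forall>n\<ge>N. X n \<in> cont_space T UNIV \<and> bielecki_dist \<gamma> T (X n) x < e"
        using X_in by blast
    qed
  qed
qed

section \<open>Nonlocal fractional integral equations\<close>

text \<open>
  Picard's operator \<open>\<Phi>\<close> is a contraction for the Bielecki distance. A difference of size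
  \<open>D * exp (\<gamma> * \<zeta>)\<close> in the argument becomes at most \<open>l * D * exp (\<gamma> * s) / \<gamma> powr q\<close> in the Abel
  integral divided by \<open>Gamma q\<close>, while the nonlocal term contributes at most \<open>l\<^sub>\<psi> * D\<close>.
\<close>

lemma nonlocal_abel_equation_unique_solution:
  fixes h :: "real \<Rightarrow> 'a::{real_inner,complete_space} \<Rightarrow> 'a"
  assumes q: "0 < q" "q \<le> 1" and T: "0 \<le> T" and \<gamma>: "0 < \<gamma>"
    and h_cont: "\<And>y. continuous_on {0..T} y \<Longrightarrow> continuous_on {0..T} (\<lambda>s. h s (y s))"
    and h_lip: "\<And>s x y. s \<in> {0..T} \<Longrightarrow> norm (h s x - h s y) \<le> l * norm (x - y)"
    and \<psi>_lip: "\<And>x y. x \<in> cont_space T UNIV \<Longrightarrow> y \<in> cont_space T UNIV \<Longrightarrow>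
      norm (\<psi> x - \<psi> y) \<le> l\<^sub>\<psi> * bielecki_norm \<gamma> T (\<lambda>s. x s - y s)"
    and l: "0 \<le> l" "0 \<le> l\<^sub>\<psi>" and small: "l\<^sub>\<psi> + l / \<gamma> powr q < 1"
  shows "\<exists>!x. x \<in> cont_space T UNIV \<and>
    (\<forall>s\<in>{0..T}. x s = x\<^sub>0 + \<psi> x + (1 / Gamma q) *\<^sub>R abel_integral q (\<lambda>\<zeta>. h \<zeta> (x \<zeta>)) s)"
proof -
  interpret Metric_space "cont_space T UNIV" "bielecki_dist \<gamma> T :: (real \<Rightarrow> 'a) \<Rightarrow> _"
    by (rule Metric_space_bielecki[OF T])
  define \<Phi> where "\<Phi> x = restrict
    (\<lambda>s. x\<^sub>0 + \<psi> x + (1 / Gamma q) *\<^sub>R abel_integral q (\<lambda>\<zeta>. h \<zeta> (x \<zeta>)) s) {0..T}" for x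
  have cont: "continuous_on {0..T} x" if "x \<in> cont_space T UNIV" for x :: "real \<Rightarrow> 'a"
    using that by (simp add: cont_space_def)
  have \<Phi>_in: "\<Phi> x \<in> cont_space T UNIV" if "x \<in> cont_space T UNIV" for x
    unfolding \<Phi>_def
    by (intro restrict_in_cont_space continuous_intros continuous_on_abel_integral[OF q] h_cont
        cont that UNIV_I)
  have G: "0 < Gamma q"
    using q by (intro Gamma_real_pos)
  have contraction: "bielecki_dist \<gamma> T (\<Phi> x) (\<Phi> y) \<le> (l\<^sub>\<psi> + l / \<gamma> powr q) * bielecki_dist \<gamma> T x y"
    if x: "x \<in> cont_space T UNIV" and y: "y \<in> cont_space T UNIV" for x y
  proof -
    define D where "D = bielecki_norm \<gamma> T (\<lambda>s. x s - y s)"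
    have xy: "continuous_on {0..T} (\<lambda>s. x s - y s)"
      by (intro continuous_intros cont x y)
    have "0 \<le> D"
      unfolding D_def by (rule bielecki_nonneg[OF T xy])
    have "bielecki_norm \<gamma> T (\<lambda>s. \<Phi> x s - \<Phi> y s) \<le> (l\<^sub>\<psi> + l / \<gamma> powr q) * D"
    proof (rule bielecki_least[OF T])
      fix s assume s: "s \<in> {0..T}"
      define a where "a z = abel_integral q (\<lambda>\<zeta>. h \<zeta> (z \<zeta>)) s" for z
      have sub: "continuous_on {0..s} (\<lambda>\<zeta>. h \<zeta> (z \<zeta>))" if "z \<in> cont_space T UNIV" for z
        using s by (intro continuous_on_subset[OF h_cont[OF cont[OF that]]]) auto
      have "norm (a x - a y) \<le> integral {0..s} (\<lambda>\<zeta>. (s - \<zeta>) powr (q - 1) * (l * D * exp (\<gamma> * \<zeta>)))"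
        unfolding a_def
      proof (rule abel_integral_diff_le)
        fix \<zeta> assume "\<zeta> \<in> {0..s}"
        then have \<zeta>: "\<zeta> \<in> {0..T}"
          using s by auto
        have "norm (h \<zeta> (x \<zeta>) - h \<zeta> (y \<zeta>)) \<le> l * norm (x \<zeta> - y \<zeta>)"
          by (rule h_lip[OF \<zeta>])
        also have "\<dots> \<le> l * (D * exp (\<gamma> * \<zeta>))"
          unfolding D_def using l by (intro mult_left_mono norm_le_bielecki[OF xy \<zeta>])
        finally show "norm (h \<zeta> (x \<zeta>) - h \<zeta> (y \<zeta>)) \<le> l * D * exp (\<gamma> * \<zeta>)"
          by simp
      qed (use q s sub x y in \<open>auto intro!: continuous_intros\<close>)
      also have "\<dots> = l * D * integral {0..s} (\<lambda>\<zeta>. (s - \<zeta>) powr (q - 1) * exp (\<gamma> * \<zeta>))"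
        by (subst integral_mult_right[symmetric]) (simp add: algebra_simps)
      also have "\<dots> \<le> l * D * (exp (\<gamma> * s) * (Gamma q / \<gamma> powr q))"
        using q \<gamma> s l \<open>0 \<le> D\<close> by (intro mult_left_mono integral_abel_kernel_exp_le) auto
      finally have "(1 / Gamma q) * norm (a x - a y) \<le> (1 / Gamma q) * (l * D * (exp (\<gamma> * s) * (Gamma q / \<gamma> powr q)))"
        using G by (intro mult_left_mono) auto
      also have "\<dots> = exp (\<gamma> * s) * (l / \<gamma> powr q * D)"
        using G by simp
      finally have a_le: "(1 / Gamma q) * norm (a x - a y) \<le> exp (\<gamma> * s) * (l / \<gamma> powr q * D)" .
      have \<psi>_le: "norm (\<psi> x - \<psi> y) \<le> exp (\<gamma> * s) * (l\<^sub>\<psi> * D)"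
      proof -
        have "norm (\<psi> x - \<psi> y) \<le> 1 * (l\<^sub>\<psi> * D)"
          using \<psi>_lip[OF x y] by (simp add: D_def)
        also have "\<dots> \<le> exp (\<gamma> * s) * (l\<^sub>\<psi> * D)"
          using \<gamma> s l \<open>0 \<le> D\<close> by (intro mult_right_mono) auto
        finally show ?thesis .
      qed
      have "\<Phi> x s - \<Phi> y s = (\<psi> x - \<psi> y) + (1 / Gamma q) *\<^sub>R (a x - a y)"
        using s by (simp add: \<Phi>_def a_def scaleR_diff_right)
      then have "norm (\<Phi> x s - \<Phi> y s) \<le> norm (\<psi> x - \<psi> y) + (1 / Gamma q) * norm (a x - a y)"
        using norm_triangle_ineq[of "\<psi> x - \<psi> y" "(1 / Gamma q) *\<^sub>R (a x - a y)"] G by simp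
      also have "\<dots> \<le> exp (\<gamma> * s) * ((l\<^sub>\<psi> + l / \<gamma> powr q) * D)"
        using a_le \<psi>_le by (simp add: algebra_simps)
      finally have "exp (- (\<gamma> * s)) * norm (\<Phi> x s - \<Phi> y s)
          \<le> exp (- (\<gamma> * s)) * (exp (\<gamma> * s) * ((l\<^sub>\<psi> + l / \<gamma> powr q) * D))"
        by (intro mult_left_mono) auto
      also have "\<dots> = (l\<^sub>\<psi> + l / \<gamma> powr q) * D"
        by (simp add: mult.assoc[symmetric] flip: exp_add)
      finally show "exp (- (\<gamma> * s)) * norm (\<Phi> x s - \<Phi> y s) \<le> (l\<^sub>\<psi> + l / \<gamma> powr q) * D" .
    qed
    then show ?thesis
      by (simp add: bielecki_dist_eq[OF T] x y \<Phi>_in D_def)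
  qed
  have fix_iff: "\<Phi> x = x \<longleftrightarrow> (\<forall>s\<in>{0..T}. x s = x\<^sub>0 + \<psi> x + (1 / Gamma q) *\<^sub>R abel_integral q (\<lambda>\<zeta>. h \<zeta> (x \<zeta>)) s)"
    if "x \<in> cont_space T UNIV" for x
  proof
    assume "\<Phi> x = x"
    then have "x s = \<Phi> x s" for s
      by simp
    then show "\<forall>s\<in>{0..T}. x s = x\<^sub>0 + \<psi> x + (1 / Gamma q) *\<^sub>R abel_integral q (\<lambda>\<zeta>. h \<zeta> (x \<zeta>)) s"
      by (simp add: \<Phi>_def)
  next
    assume "\<forall>s\<in>{0..T}. x s = x\<^sub>0 + \<psi> x + (1 / Gamma q) *\<^sub>R abel_integral q (\<lambda>\<zeta>. h \<zeta> (x \<zeta>)) s"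
    then show "\<Phi> x = x"
      by (intro cont_space_eqI[OF \<Phi>_in[OF that] that]) (simp add: \<Phi>_def)
  qed
  have "restrict (\<lambda>_. 0) {0..T} \<in> cont_space T (UNIV :: 'a set)"
    by (intro restrict_in_cont_space continuous_intros UNIV_I)
  then obtain x where x: "x \<in> cont_space T UNIV" "\<Phi> x = x"
    using Banach_fixedpoint_thm[OF mcomplete_bielecki[OF T less_imp_le[OF \<gamma>]] _ _ small contraction]
      \<Phi>_in by blast
  have unique: "y = x" if y: "y \<in> cont_space T UNIV" "\<Phi> y = y" for y
  proof -
    have "bielecki_dist \<gamma> T y x \<le> (l\<^sub>\<psi> + l / \<gamma> powr q) * bielecki_dist \<gamma> T y x"
      using contraction[OF y(1) x(1)] x y by simp
    then have "(1 - (l\<^sub>\<psi> + l / \<gamma> powr q)) * bielecki_dist \<gamma> T y x \<le> 0"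
      by (simp add: left_diff_distrib)
    then have "bielecki_dist \<gamma> T y x \<le> 0"
      using small by (simp add: mult_le_0_iff)
    then show ?thesis
      using nonneg[of y x] zero[OF y(1) x(1)] by simp
  qed
  show ?thesis
  proof (rule ex1I)
    show "x \<in> cont_space T UNIV \<and>
        (\<forall>s\<in>{0..T}. x s = x\<^sub>0 + \<psi> x + (1 / Gamma q) *\<^sub>R abel_integral q (\<lambda>\<zeta>. h \<zeta> (x \<zeta>)) s)"
      using x fix_iff[OF x(1)] by blast
    fix y assume "y \<in> cont_space T UNIV \<and>
        (\<forall>s\<in>{0..T}. y s = x\<^sub>0 + \<psi> y + (1 / Gamma q) *\<^sub>R abel_integral q (\<lambda>\<zeta>. h \<zeta> (y \<zeta>)) s)"
    then show "y = x"
      using fix_iff[of y] unique[of y] by blast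
  qed
qed

section \<open>The coupled problem\<close>

lemma Ex1_graph:
  assumes "\<exists>!x. P x"
  shows "\<exists>!(x, u). P x \<and> u = F x"
proof -
  obtain x where x: "P x" "\<And>y. P y \<Longrightarrow> y = x"
    using assms by blast
  show ?thesis
  proof (rule ex1I[of _ "(x, F x)"])
    fix p assume "case p of (x, u) \<Rightarrow> P x \<and> u = F x"
    then show "p = (x, F x)"
      using x(2) by (cases p) auto
  qed (use x(1) in simp)
qed

theorem theorem3p1:
  fixes q l\<^sub>G \<eta>\<^sub>G l\<^sub>K l\<^sub>g l\<^sub>f l\<^sub>\<psi> :: real
  assumes "0 < q" "q \<le> 1"
    and "0 < l\<^sub>G" "0 < \<eta>\<^sub>G" "0 \<le> l\<^sub>K" "0 < l\<^sub>g" "0 < l\<^sub>f" "0 < l\<^sub>\<psi>" "l\<^sub>\<psi> < 1"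
    and "2 * (l\<^sub>K\<^sup>2 / \<eta>\<^sub>G\<^sup>2) * (l\<^sub>G * sqrt (4 * l\<^sub>G\<^sup>2 + 2 * \<eta>\<^sub>G\<^sup>2) + 2 * l\<^sub>G\<^sup>2 + \<eta>\<^sub>G\<^sup>2) < 1"
  shows "\<exists>\<gamma>\<^sub>0>0. \<forall>\<gamma>\<ge>\<gamma>\<^sub>0. \<forall>(T::real)
      (\<Omega> :: ('b::{real_inner, complete_space}) set) (K :: 'b \<Rightarrow> 'b set)
      (f :: real \<Rightarrow> ('a::{real_inner, complete_space}) \<Rightarrow> 'a)
      (g :: real \<Rightarrow> 'a \<Rightarrow> 'b \<Rightarrow> 'a) (G :: real \<Rightarrow> 'a \<Rightarrow> 'b \<Rightarrow> 'b)
      (\<psi> :: (real \<Rightarrow> 'a) \<Rightarrow> 'a) (x\<^sub>0 :: 'a).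
    0 < T \<and> \<Omega> \<noteq> {} \<and> closed \<Omega> \<and> convex \<Omega> \<and>
    (\<forall>u\<in>\<Omega>. K u \<subseteq> \<Omega> \<and> K u \<noteq> {} \<and> closed (K u) \<and> convex (K u)) \<and>
    (\<forall>s\<^sub>1\<in>{0..T}. \<forall>s\<^sub>2\<in>{0..T}. \<forall>x\<^sub>1 x\<^sub>2. \<forall>u\<^sub>1\<in>\<Omega>. \<forall>u\<^sub>2\<in>\<Omega>.
       norm (G s\<^sub>2 x\<^sub>2 u\<^sub>2 - G s\<^sub>1 x\<^sub>1 u\<^sub>1) \<le>
         l\<^sub>G * (\<bar>s\<^sub>2 - s\<^sub>1\<bar> + norm (x\<^sub>2 - x\<^sub>1) + norm (u\<^sub>2 - u\<^sub>1))) \<and>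
    (\<forall>s\<in>{0..T}. \<forall>x. \<forall>u\<in>\<Omega>. \<forall>u\<^sub>1\<in>K u. \<forall>u\<^sub>2\<in>K u.
       inner (G s x u\<^sub>2) (u\<^sub>1 - u\<^sub>2) \<ge> 0 \<longrightarrow>
       inner (G s x u\<^sub>1) (u\<^sub>1 - u\<^sub>2) \<ge> \<eta>\<^sub>G * (norm (u\<^sub>1 - u\<^sub>2))\<^sup>2) \<and>
    (\<forall>u\<^sub>1\<in>\<Omega>. \<forall>u\<^sub>2\<in>\<Omega>. \<forall>w.
       norm (metric_projection (K u\<^sub>2) w - metric_projection (K u\<^sub>1) w) \<le> l\<^sub>K * norm (u\<^sub>2 - u\<^sub>1)) \<and>
    continuous_on ({0..T} \<times> UNIV \<times> UNIV) (\<lambda>(s, x, u). g s x u) \<and>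
    (\<forall>s\<in>{0..T}. \<forall>x\<^sub>1 x\<^sub>2 u\<^sub>1 u\<^sub>2.
       norm (g s x\<^sub>2 u\<^sub>2 - g s x\<^sub>1 u\<^sub>1) \<le> l\<^sub>g * (norm (x\<^sub>2 - x\<^sub>1) + norm (u\<^sub>2 - u\<^sub>1))) \<and>
    continuous_on ({0..T} \<times> UNIV) (\<lambda>(s, x). f s x) \<and>
    (\<forall>s\<in>{0..T}. \<forall>x\<^sub>1 x\<^sub>2. norm (f s x\<^sub>2 - f s x\<^sub>1) \<le> l\<^sub>f * norm (x\<^sub>2 - x\<^sub>1)) \<and>
    bielecki_continuous \<gamma> T \<psi> \<and>
    (\<forall>y\<^sub>1\<in>cont_space T UNIV. \<forall>y\<^sub>2\<in>cont_space T UNIV.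
       norm (\<psi> y\<^sub>2 - \<psi> y\<^sub>1) \<le> l\<^sub>\<psi> * bielecki_norm \<gamma> T (\<lambda>s. y\<^sub>2 s - y\<^sub>1 s))
    \<longrightarrow> (\<exists>!(x, u). is_solution q T \<Omega> K f g G \<psi> x\<^sub>0 x u)"
proof -
  define \<kappa> where "\<kappa> = l\<^sub>K * (1 + l\<^sub>G / \<eta>\<^sub>G)"
  have \<kappa>: "\<kappa> < 1"
    unfolding \<kappa>_def using assms(3-5,10) by (intro qvi_contraction_constant) auto
  define l\<^sub>U where "l\<^sub>U = l\<^sub>G / (\<eta>\<^sub>G * (1 - \<kappa>))"
  define l where "l = l\<^sub>f + l\<^sub>g * (1 + l\<^sub>U)"
  \<comment> \<open>Chosen so that \<open>l / \<gamma> powr q \<le> (1 - l\<^sub>\<psi>) / 2\<close> for all \<open>\<gamma> \<ge> \<gamma>\<^sub>0\<close>.\<close>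
  define \<gamma>\<^sub>0 where "\<gamma>\<^sub>0 = (2 * l / (1 - l\<^sub>\<psi>)) powr (1 / q)"
  have "0 < l\<^sub>U"
    unfolding l\<^sub>U_def using assms(3,4) \<kappa> by simp
  then have "0 < l"
    unfolding l_def using assms(6,7) by (intro add_pos_pos mult_pos_pos) auto
  then have "0 < \<gamma>\<^sub>0"
    unfolding \<gamma>\<^sub>0_def using assms(9) by simp
  have small: "l\<^sub>\<psi> + l / \<gamma> powr q < 1" if "\<gamma> \<ge> \<gamma>\<^sub>0" for \<gamma>
  proof -
    have "2 * l / (1 - l\<^sub>\<psi>) = \<gamma>\<^sub>0 powr q"
      unfolding \<gamma>\<^sub>0_def using assms(1,9) \<open>0 < l\<close> by (simp add: powr_powr)
    also have "\<dots> \<le> \<gamma> powr q"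
      using that \<open>0 < \<gamma>\<^sub>0\<close> assms(1) by (intro powr_mono2) auto
    finally have "2 * l \<le> (1 - l\<^sub>\<psi>) * \<gamma> powr q"
      using assms(9) by (simp add: pos_divide_le_eq mult.commute)
    moreover have "0 < \<gamma> powr q"
      using that \<open>0 < \<gamma>\<^sub>0\<close> by simp
    ultimately have "l / \<gamma> powr q \<le> (1 - l\<^sub>\<psi>) / 2"
      by (simp add: pos_divide_le_eq)
    also have "(1 - l\<^sub>\<psi>) / 2 < 1 - l\<^sub>\<psi>"
      using assms(9) by simp
    finally show ?thesis
      unfolding less_diff_eq by (subst add.commute)
  qed
  show ?thesis
  proof (intro exI[of _ \<gamma>\<^sub>0] conjI \<open>0 < \<gamma>\<^sub>0\<close> allI impI, elim conjE)
    fix \<gamma> T :: real and \<Omega> :: "'b set" and K and f :: "real \<Rightarrow> 'a \<Rightarrow> 'a"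
      and g :: "real \<Rightarrow> 'a \<Rightarrow> 'b \<Rightarrow> 'a" and G :: "real \<Rightarrow> 'a \<Rightarrow> 'b \<Rightarrow> 'b"
      and \<psi> :: "(real \<Rightarrow> 'a) \<Rightarrow> 'a" and x\<^sub>0 :: 'a
    assume \<gamma>: "\<gamma>\<^sub>0 \<le> \<gamma>" and T: "0 < T" and \<Omega>: "\<Omega> \<noteq> {}" "closed \<Omega>"
      and K: "\<forall>u\<in>\<Omega>. K u \<subseteq> \<Omega> \<and> K u \<noteq> {} \<and> closed (K u) \<and> convex (K u)"
      and G_lip: "\<forall>s\<^sub>1\<in>{0..T}. \<forall>s\<^sub>2\<in>{0..T}. \<forall>x\<^sub>1 x\<^sub>2. \<forall>u\<^sub>1\<in>\<Omega>. \<forall>u\<^sub>2\<in>\<Omega>.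
        norm (G s\<^sub>2 x\<^sub>2 u\<^sub>2 - G s\<^sub>1 x\<^sub>1 u\<^sub>1) \<le> l\<^sub>G * (\<bar>s\<^sub>2 - s\<^sub>1\<bar> + norm (x\<^sub>2 - x\<^sub>1) + norm (u\<^sub>2 - u\<^sub>1))"
      and G_pseudo: "\<forall>s\<in>{0..T}. \<forall>x. \<forall>u\<in>\<Omega>. \<forall>u\<^sub>1\<in>K u. \<forall>u\<^sub>2\<in>K u.
        inner (G s x u\<^sub>2) (u\<^sub>1 - u\<^sub>2) \<ge> 0 \<longrightarrow>
        inner (G s x u\<^sub>1) (u\<^sub>1 - u\<^sub>2) \<ge> \<eta>\<^sub>G * (norm (u\<^sub>1 - u\<^sub>2))\<^sup>2"
      and K_lip: "\<forall>u\<^sub>1\<in>\<Omega>. \<forall>u\<^sub>2\<in>\<Omega>. \<forall>w.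
        norm (metric_projection (K u\<^sub>2) w - metric_projection (K u\<^sub>1) w) \<le> l\<^sub>K * norm (u\<^sub>2 - u\<^sub>1)"
      and g_cont: "continuous_on ({0..T} \<times> UNIV \<times> UNIV) (\<lambda>(s, x, u). g s x u)"
      and g_lip: "\<forall>s\<in>{0..T}. \<forall>x\<^sub>1 x\<^sub>2 u\<^sub>1 u\<^sub>2.
        norm (g s x\<^sub>2 u\<^sub>2 - g s x\<^sub>1 u\<^sub>1) \<le> l\<^sub>g * (norm (x\<^sub>2 - x\<^sub>1) + norm (u\<^sub>2 - u\<^sub>1))"
      and f_cont: "continuous_on ({0..T} \<times> UNIV) (\<lambda>(s, x). f s x)"
      and f_lip: "\<forall>s\<in>{0..T}. \<forall>x\<^sub>1 x\<^sub>2. norm (f s x\<^sub>2 - f s x\<^sub>1) \<le> l\<^sub>f * norm (x\<^sub>2 - x\<^sub>1)"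
      and \<psi>_lip: "\<forall>y\<^sub>1\<in>cont_space T UNIV. \<forall>y\<^sub>2\<in>cont_space T UNIV.
        norm (\<psi> y\<^sub>2 - \<psi> y\<^sub>1) \<le> l\<^sub>\<psi> * bielecki_norm \<gamma> T (\<lambda>s. y\<^sub>2 s - y\<^sub>1 s)"
    interpret qvi_constraints \<Omega> K l\<^sub>K \<eta>\<^sub>G l\<^sub>G
    proof
      show "norm (metric_projection (K u) z - metric_projection (K v) z) \<le> l\<^sub>K * norm (u - v)"
        if "u \<in> \<Omega>" "v \<in> \<Omega>" for u v z
        using K_lip that by blast
      show "l\<^sub>K * (1 + l\<^sub>G / \<eta>\<^sub>G) < 1"
        using \<kappa> by (simp only: \<kappa>_def)
    qed (use \<Omega> K assms(3-5) in auto)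
    have adm: "admissible (G s x)" if "s \<in> {0..T}" for s x
      unfolding admissible_def strongly_pseudomonotone_def
    proof (intro conjI ballI impI)
      fix u v assume "u \<in> \<Omega>" "v \<in> \<Omega>"
      with G_lip that have "norm (G s x u - G s x v) \<le> l\<^sub>G * (\<bar>s - s\<bar> + norm (x - x) + norm (u - v))"
        by blast
      then show "norm (G s x u - G s x v) \<le> l\<^sub>G * norm (u - v)"
        by simp
    qed (use G_pseudo that in blast)
    define U where "U s x = (THE w. w \<in> SOL \<Omega> K (G s x))" for s x
    have U: "w \<in> SOL \<Omega> K (G s x) \<longleftrightarrow> w = U s x" if "s \<in> {0..T}" for w s x
      unfolding U_def using theI'[OF SOL_unique_solution[OF adm[OF that]]]
        SOL_unique_solution[OF adm[OF that]] by metis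
    have U_\<Omega>: "U s x \<in> \<Omega>" if "s \<in> {0..T}" for s x
      using U[OF that, of "U s x" x] by (simp add: SOL_def)
    have U_lip: "norm (U s x - U t y) \<le> l\<^sub>U * (\<bar>s - t\<bar> + norm (x - y))"
      if "s \<in> {0..T}" "t \<in> {0..T}" for s t x y
    proof -
      have "norm (U s x - U t y) \<le> norm (G s x (U t y) - G t y (U t y)) / (\<eta>\<^sub>G * (1 - \<kappa>))"
        unfolding \<kappa>_def using U that by (intro SOL_stability[OF adm]) auto
      also have "\<dots> \<le> l\<^sub>G * (\<bar>s - t\<bar> + norm (x - y) + norm (U t y - U t y)) / (\<eta>\<^sub>G * (1 - \<kappa>))"
      proof (rule divide_right_mono)
        show "norm (G s x (U t y) - G t y (U t y)) \<le> l\<^sub>G * (\<bar>s - t\<bar> + norm (x - y) + norm (U t y - U t y))"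
          using G_lip that U_\<Omega>[OF that(2)] by blast
      qed (use assms(4) \<kappa> in simp)
      finally show ?thesis
        by (simp add: l\<^sub>U_def)
    qed
    have U_cont: "continuous_on {0..T} (\<lambda>s. U s (y s))" if y: "continuous_on {0..T} y" for y
      unfolding continuous_on_def
    proof
      fix s assume s: "s \<in> {0..T}"
      have ys: "(y \<longlongrightarrow> y s) (at s within {0..T})"
        using y s by (simp add: continuous_on_def)
      have "((\<lambda>t. l\<^sub>U * (\<bar>t - s\<bar> + norm (y t - y s))) \<longlongrightarrow> l\<^sub>U * (\<bar>s - s\<bar> + norm (y s - y s))) (at s within {0..T})"
        by (intro tendsto_intros ys)
      then have lim: "((\<lambda>t. l\<^sub>U * (\<bar>t - s\<bar> + norm (y t - y s))) \<longlongrightarrow> 0) (at s within {0..T})"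
        by simp
      show "((\<lambda>t. U t (y t)) \<longlongrightarrow> U s (y s)) (at s within {0..T})"
      proof (rule tendsto_dist_iff[THEN iffD2], rule tendsto_sandwich[OF _ _ tendsto_const lim])
        show "\<forall>\<^sub>F t in at s within {0..T}. dist (U t (y t)) (U s (y s)) \<le> l\<^sub>U * (\<bar>t - s\<bar> + norm (y t - y s))"
          using U_lip[OF _ s] by (auto simp: eventually_at_filter dist_norm)
      qed simp
    qed
    define h where "h s x = f s x + g s x (U s x)" for s x
    have h_cont: "continuous_on {0..T} (\<lambda>s. h s (y s))" if y: "continuous_on {0..T} y" for y
    proof -
      have "continuous_on {0..T} (\<lambda>s. (\<lambda>(s, x). f s x) (s, y s))"
        by (rule continuous_on_compose2[OF f_cont]) (auto intro!: continuous_intros y)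
      moreover have "continuous_on {0..T} (\<lambda>s. (\<lambda>(s, x, u). g s x u) (s, y s, U s (y s)))"
        by (rule continuous_on_compose2[OF g_cont]) (auto intro!: continuous_intros y U_cont)
      ultimately show ?thesis
        unfolding h_def by (simp add: continuous_on_add)
    qed
    have h_lip: "norm (h s x - h s y) \<le> l * norm (x - y)" if s: "s \<in> {0..T}" for s x y
    proof -
      have "norm (h s x - h s y) \<le> norm (f s x - f s y) + norm (g s x (U s x) - g s y (U s y))"
        unfolding h_def by (rule norm_diff_triangle_ineq)
      also have "\<dots> \<le> l\<^sub>f * norm (x - y) + l\<^sub>g * (norm (x - y) + l\<^sub>U * norm (x - y))"
      proof (rule add_mono)
        have "norm (g s x (U s x) - g s y (U s y)) \<le> l\<^sub>g * (norm (x - y) + norm (U s x - U s y))"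
          using g_lip s by blast
        also have "\<dots> \<le> l\<^sub>g * (norm (x - y) + l\<^sub>U * norm (x - y))"
          using U_lip[OF s s, of x y] assms(6) by (intro mult_left_mono add_left_mono) auto
        finally show "norm (g s x (U s x) - g s y (U s y)) \<le> l\<^sub>g * (norm (x - y) + l\<^sub>U * norm (x - y))" .
      qed (use f_lip s in blast)
      also have "\<dots> = l * norm (x - y)"
        by (simp add: l_def algebra_simps)
      finally show ?thesis .
    qed
    \<comment> \<open>The control is determined by the state, so solutions correspond to fixed points of the state
      equation.\<close>
    have solution_iff: "is_solution q T \<Omega> K f g G \<psi> x\<^sub>0 x u \<longleftrightarrow>
        (x \<in> cont_space T UNIV \<and>
          (\<forall>s\<in>{0..T}. x s = x\<^sub>0 + \<psi> x + (1 / Gamma q) *\<^sub>R abel_integral q (\<lambda>\<zeta>. h \<zeta> (x \<zeta>)) s)) \<and>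
        u = restrict (\<lambda>s. U s (x s)) {0..T}" for x u
    proof (cases "x \<in> cont_space T UNIV \<and> u = restrict (\<lambda>s. U s (x s)) {0..T}")
      case False
      moreover have "u = restrict (\<lambda>s. U s (x s)) {0..T}" if "is_solution q T \<Omega> K f g G \<psi> x\<^sub>0 x u"
      proof
        fix s
        show "u s = restrict (\<lambda>s. U s (x s)) {0..T} s"
          using that U unfolding is_solution_def cont_space_def
          by (cases "s \<in> {0..T}") (auto simp: PiE_def extensional_def)
      qed
      ultimately show ?thesis
        unfolding is_solution_def by blast
    next
      case True
      then have x: "continuous_on {0..T} x" and u: "\<And>s. s \<in> {0..T} \<Longrightarrow> u s = U s (x s)"
        by (auto simp: cont_space_def)
      have "u \<in> cont_space T \<Omega>"
        unfolding conjunct2[OF True] by (intro restrict_in_cont_space U_cont U_\<Omega> x)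
      define c where "c \<zeta> = f \<zeta> (x \<zeta>) + g \<zeta> (x \<zeta>) (u \<zeta>)" for \<zeta>
      have c: "c \<zeta> = h \<zeta> (x \<zeta>)" if "\<zeta> \<in> {0..T}" for \<zeta>
        by (simp add: c_def h_def u[OF that])
      have "continuous_on {0..T} c"
        using continuous_on_cong[of "{0..T}" "{0..T}" c "\<lambda>\<zeta>. h \<zeta> (x \<zeta>)"] c h_cont[OF x] by blast
      then have c_cont: "continuous_on {0..s} c" if "s \<in> {0..T}" for s
        using that by (auto intro: continuous_on_subset)
      have int: "bochner_integrable (lebesgue_on {0..s}) (\<lambda>\<zeta>. (s - \<zeta>) powr (q - 1) *\<^sub>R c \<zeta>)"
        if "s \<in> {0..T}" for s
        using assms(1) c_cont[OF that] that by (intro bochner_integrable_abel) auto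
      have eq: "abel_integral q c s = abel_integral q (\<lambda>\<zeta>. h \<zeta> (x \<zeta>)) s" if "s \<in> {0..T}" for s
        using assms(1) c_cont[OF that] that c by (intro abel_integral_cong) auto
      have "u s \<in> SOL \<Omega> K (G s (x s))" if "s \<in> {0..T}" for s
        using U[OF that] u[OF that] by blast
      with True \<open>u \<in> cont_space T \<Omega>\<close> int eq show ?thesis
        unfolding is_solution_def c_def[symmetric] abel_integral_def[symmetric] by simp
    qed
    have "\<exists>!x. x \<in> cont_space T UNIV \<and>
        (\<forall>s\<in>{0..T}. x s = x\<^sub>0 + \<psi> x + (1 / Gamma q) *\<^sub>R abel_integral q (\<lambda>\<zeta>. h \<zeta> (x \<zeta>)) s)"
    proof (rule nonlocal_abel_equation_unique_solution[OF assms(1,2) _ _ h_cont h_lip])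
      show "norm (\<psi> x - \<psi> y) \<le> l\<^sub>\<psi> * bielecki_norm \<gamma> T (\<lambda>s. x s - y s)"
        if "x \<in> cont_space T UNIV" "y \<in> cont_space T UNIV" for x y
        using \<psi>_lip that by blast
    qed (use T \<gamma> \<open>0 < \<gamma>\<^sub>0\<close> \<open>0 < l\<close> assms(8) small in auto)
    then show "\<exists>!(x, u). is_solution q T \<Omega> K f g G \<psi> x\<^sub>0 x u"
      unfolding solution_iff by (rule Ex1_graph)
  qed
qed

end
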